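(* Fix $p\in(0,1)$. For each positive integer $n$ let $\{I_{i,j}:1\le i<j\le n\}$ be independent Bernoulli$(p)$ random variables (edge indicators of a Bernoulli random graph $G(n,p)$), and let $$\mathbf{T}_n(t)=\frac{\lfloor nt\rfloor-2}{n^2}\sum_{1\le i<j\le\lfloor nt\rfloor}I_{i,j},\qquad \mathbf{Y}_n(t)=\mathbf{T}_n(t)-\mathbb{E}\mathbf{T}_n(t),\qquad t\in[0,1].$$ Let $\mathbf{Z}(t)=\left(\frac{p(1-p)}{2}\right)^{1/2}t\,\mathbf{B}(t^2)$, $t\in[0,1]$, where $\mathbf{B}$ is a standard Brownian motion. Then, as $n\to\infty$, $\mathbf{Y}_n$ converges to $\mathbf{Z}$ in distribution on $D([0,1],\mathbb{R})$ with respect to both the Skorokhod and the uniform topologies.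
   Context: $D([0,1],\mathbb{R})$ is the Skorokhod space of càdlàg functions $[0,1]\to\mathbb{R}$; the uniform topology is that of the norm $\|w\|=\sup_{t\in[0,1]}|w(t)|$. *)

theory Defs
  imports "HOL-Probability.Probability"
begin

section \<open>The Skorokhod space \<open>D([0,1],\<real>)\<close>\<close>

text \<open>Functions are \<^const>\<open>extensional\<close>, i.e. \<^const>\<open>undefined\<close> outside \<open>[0,1]\<close>, so that
  equality of functions means equality on \<open>[0,1]\<close>.\<close>

definition cadlag :: "(real \<Rightarrow> real) set" where
  "cadlag = {x \<in> extensional {0..1}.
     (\<forall>t\<in>{0..<1}. (x \<longlongrightarrow> x t) (at_right t)) \<and>
     (\<forall>t\<in>{0<..1}. \<exists>l. (x \<longlongrightarrow> l) (at_left t))}"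

text \<open>The locale \<^locale>\<open>Metric_space\<close> wants nonnegativity and symmetry on the whole type; hence
  the value \<open>0\<close> outside the carrier in both distances.\<close>

definition uniform_dist :: "(real \<Rightarrow> real) \<Rightarrow> (real \<Rightarrow> real) \<Rightarrow> real" where
  "uniform_dist x y =
     (if x \<in> cadlag \<and> y \<in> cadlag then (SUP t\<in>{0..1}. \<bar>x t - y t\<bar>) else 0)"

definition time_changes :: "(real \<Rightarrow> real) set" where
  "time_changes = {\<phi>. strict_mono_on {0..1} \<phi> \<and> continuous_on {0..1} \<phi> \<and> \<phi> ` {0..1} = {0..1}}"

definition skorokhod_radii :: "(real \<Rightarrow> real) \<Rightarrow> (real \<Rightarrow> real) \<Rightarrow> real set" where
  "skorokhod_radii x y = {e. \<exists>\<phi>\<in>time_changes. \<forall>t\<in>{0..1}. \<bar>\<phi> t - t\<bar> \<le> e \<and> \<bar>x t - y (\<phi> t)\<bar> \<le> e}"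

definition skorokhod_dist :: "(real \<Rightarrow> real) \<Rightarrow> (real \<Rightarrow> real) \<Rightarrow> real" where
  "skorokhod_dist x y =
     (if x \<in> cadlag \<and> y \<in> cadlag then Inf (skorokhod_radii x y) else 0)"

definition uniform_topology :: "(real \<Rightarrow> real) topology" where
  "uniform_topology = Metric_space.mtopology cadlag uniform_dist"

definition skorokhod_topology :: "(real \<Rightarrow> real) topology" where
  "skorokhod_topology = Metric_space.mtopology cadlag skorokhod_dist"

lemma cadlag_bounded:
  assumes "x \<in> cadlag"
  obtains B where "\<And>t. t \<in> {0..1} \<Longrightarrow> \<bar>x t\<bar> \<le> B"
proof -
  have loc: "\<exists>B U. open U \<and> t \<in> U \<and> (\<forall>s\<in>U. s \<in> {0..1} \<longrightarrow> \<bar>x s\<bar> \<le> B)" if t: "t \<in> {0..1}" for t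
  proof -
    have "\<exists>B. eventually (\<lambda>s. s \<in> {0..1} \<longrightarrow> \<bar>x s\<bar> \<le> B) (at_right t)"
    proof (cases "t < 1")
      case True
      then have "(x \<longlongrightarrow> x t) (at_right t)" using assms t by (auto simp: cadlag_def)
      then have "eventually (\<lambda>s. dist (x s) (x t) < 1) (at_right t)" by (rule tendstoD) simp
      then have "eventually (\<lambda>s. s \<in> {0..1} \<longrightarrow> \<bar>x s\<bar> \<le> \<bar>x t\<bar> + 1) (at_right t)"
        by (rule eventually_mono) (auto simp: dist_real_def)
      then show ?thesis by blast
    next
      case False
      have "eventually (\<lambda>s. s \<in> {0..1} \<longrightarrow> \<bar>x s\<bar> \<le> 0) (at_right t)"
        using False by (auto simp: eventually_at_filter)
      then show ?thesis by blast
    qed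
    then obtain B1 where B1: "eventually (\<lambda>s. s \<in> {0..1} \<longrightarrow> \<bar>x s\<bar> \<le> B1) (at_right t)" by blast
    have "\<exists>B. eventually (\<lambda>s. s \<in> {0..1} \<longrightarrow> \<bar>x s\<bar> \<le> B) (at_left t)"
    proof (cases "t > 0")
      case True
      then have "t \<in> {0<..1}" using t by simp
      then obtain l where "(x \<longlongrightarrow> l) (at_left t)" using assms unfolding cadlag_def by blast
      then have "eventually (\<lambda>s. dist (x s) l < 1) (at_left t)" by (rule tendstoD) simp
      then have "eventually (\<lambda>s. s \<in> {0..1} \<longrightarrow> \<bar>x s\<bar> \<le> \<bar>l\<bar> + 1) (at_left t)"
        by (rule eventually_mono) (auto simp: dist_real_def)
      then show ?thesis by blast
    next
      case False
      have "eventually (\<lambda>s. s \<in> {0..1} \<longrightarrow> \<bar>x s\<bar> \<le> 0) (at_left t)"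
        using False by (auto simp: eventually_at_filter)
      then show ?thesis by blast
    qed
    then obtain B2 where B2: "eventually (\<lambda>s. s \<in> {0..1} \<longrightarrow> \<bar>x s\<bar> \<le> B2) (at_left t)" by blast
    define B where "B = max (max B1 B2) \<bar>x t\<bar>"
    have "eventually (\<lambda>s. s \<in> {0..1} \<longrightarrow> \<bar>x s\<bar> \<le> B) (at t)"
      unfolding eventually_at_split
      using B1 B2 by (auto elim!: eventually_mono simp: B_def)
    then obtain U where "open U" "t \<in> U" "\<forall>s\<in>U. s \<noteq> t \<longrightarrow> s \<in> {0..1} \<longrightarrow> \<bar>x s\<bar> \<le> B"
      unfolding eventually_at_topological by blast
    then have "open U \<and> t \<in> U \<and> (\<forall>s\<in>U. s \<in> {0..1} \<longrightarrow> \<bar>x s\<bar> \<le> B)"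
      by (auto simp: B_def)
    then show ?thesis by blast
  qed
  then obtain B U where U: "\<And>t. t \<in> {0..1} \<Longrightarrow> open (U t) \<and> t \<in> U t \<and> (\<forall>s\<in>U t. s \<in> {0..1} \<longrightarrow> \<bar>x s\<bar> \<le> B t)"
    by metis
  have "compact {0..1::real}" by simp
  then obtain C where C: "C \<subseteq> {0..1}" "finite C" "{0..1} \<subseteq> (\<Union>c\<in>C. U c)"
    by (rule compactE_image[of _ "{0..1}" U]) (use U in auto)
  have "\<bar>x t\<bar> \<le> (\<Sum>c\<in>C. \<bar>B c\<bar>)" if t: "t \<in> {0..1}" for t
  proof -
    obtain c where c: "c \<in> C" "t \<in> U c" using C t by blast
    have "\<bar>x t\<bar> \<le> \<bar>B c\<bar>" using U[of c] c C t by fastforce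
    also have "\<dots> \<le> (\<Sum>c\<in>C. \<bar>B c\<bar>)" by (rule member_le_sum) (use c C in auto)
    finally show ?thesis .
  qed
  then show thesis using that by blast
qed

lemma cadlag_eqI:
  "x \<in> cadlag \<Longrightarrow> y \<in> cadlag \<Longrightarrow> (\<And>t. t \<in> {0..1} \<Longrightarrow> x t = y t) \<Longrightarrow> x = y"
  by (rule extensionalityI[of _ "{0..1}"]) (auto simp: cadlag_def)

lemma uniform_dist_bdd:
  assumes "x \<in> cadlag" "y \<in> cadlag"
  shows "bdd_above ((\<lambda>t. \<bar>x t - y t\<bar>) ` {0..1})"
proof -
  obtain B where "\<And>t. t \<in> {0..1} \<Longrightarrow> \<bar>x t\<bar> \<le> B" using cadlag_bounded assms(1) by blast
  moreover obtain C where "\<And>t. t \<in> {0..1} \<Longrightarrow> \<bar>y t\<bar> \<le> C" using cadlag_bounded assms(2) by blast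
  ultimately show ?thesis by (intro bdd_aboveI2[of _ _ "B + C"] order_trans[OF abs_triangle_ineq4] add_mono)
qed

lemma uniform_dist_ge:
  assumes "x \<in> cadlag" "y \<in> cadlag" "t \<in> {0..1}"
  shows "\<bar>x t - y t\<bar> \<le> uniform_dist x y"
  using cSUP_upper[OF assms(3) uniform_dist_bdd[OF assms(1,2)]] assms by (simp add: uniform_dist_def)

lemma uniform_dist_le:
  assumes "x \<in> cadlag" "y \<in> cadlag" "\<And>t. t \<in> {0..1} \<Longrightarrow> \<bar>x t - y t\<bar> \<le> c"
  shows "uniform_dist x y \<le> c"
proof -
  have "(SUP t\<in>{0..1}. \<bar>x t - y t\<bar>) \<le> c"
    by (rule cSUP_least) (use assms in auto)
  then show ?thesis using assms by (simp add: uniform_dist_def)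
qed

lemma Metric_space_uniform: "Metric_space cadlag uniform_dist"
proof
  fix x y :: "real \<Rightarrow> real"
  show "0 \<le> uniform_dist x y"
  proof (cases "x \<in> cadlag \<and> y \<in> cadlag")
    case True
    then have "\<bar>x 0 - y 0\<bar> \<le> uniform_dist x y" by (intro uniform_dist_ge) auto
    then show ?thesis by linarith
  qed (auto simp: uniform_dist_def)
  show "uniform_dist x y = uniform_dist y x"
    by (auto simp: uniform_dist_def abs_minus_commute)
next
  fix x y :: "real \<Rightarrow> real"
  assume xy: "x \<in> cadlag" "y \<in> cadlag"
  show "uniform_dist x y = 0 \<longleftrightarrow> x = y"
  proof
    assume 0: "uniform_dist x y = 0"
    show "x = y"
      by (rule cadlag_eqI[OF xy]) (use uniform_dist_ge[OF xy] 0 in force)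
  qed (use xy in \<open>simp add: uniform_dist_def\<close>)
next
  fix x y z :: "real \<Rightarrow> real"
  assume xyz: "x \<in> cadlag" "y \<in> cadlag" "z \<in> cadlag"
  show "uniform_dist x z \<le> uniform_dist x y + uniform_dist y z"
  proof (rule uniform_dist_le[OF xyz(1,3)])
    fix t :: real assume "t \<in> {0..1}"
    then have "\<bar>x t - y t\<bar> \<le> uniform_dist x y" "\<bar>y t - z t\<bar> \<le> uniform_dist y z"
      using uniform_dist_ge xyz by blast+
    then show "\<bar>x t - z t\<bar> \<le> uniform_dist x y + uniform_dist y z" by linarith
  qed
qed

lemma time_changesD:
  assumes "l \<in> time_changes"
  shows "t \<in> {0..1} \<Longrightarrow> l t \<in> {0..1}" "inj_on l {0..1}" "l 1 = 1"
proof -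
  have im: "l ` {0..1} = {0..1}" and mono: "strict_mono_on {0..1} l"
    using assms by (auto simp: time_changes_def)
  show "t \<in> {0..1} \<Longrightarrow> l t \<in> {0..1}" using im by blast
  show "inj_on l {0..1}" using mono by (rule strict_mono_on_imp_inj_on)
  obtain s where s: "s \<in> {0..1}" "l s = 1" using im by (metis atLeastAtMost_iff image_iff order_refl zero_le_one)
  have "l 1 \<in> {0..1}" using im by auto
  moreover have "s < 1 \<Longrightarrow> l s < l 1" using strict_mono_onD[OF mono, of s 1] s(1) by auto
  ultimately show "l 1 = 1" using s by (cases "s = 1") auto
qed

lemma time_changes_id: "(\<lambda>t. t) \<in> time_changes"
  by (auto simp: time_changes_def strict_mono_on_def)

lemma time_changes_comp:
  assumes "l \<in> time_changes" "m \<in> time_changes"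
  shows "m \<circ> l \<in> time_changes"
proof -
  have "continuous_on {0..1} (m \<circ> l)"
    using assms unfolding time_changes_def by (intro continuous_on_compose) auto
  moreover have "(m \<circ> l) ` {0..1} = {0..1}"
    using assms unfolding time_changes_def image_comp[symmetric] by simp
  moreover have "strict_mono_on {0..1} (m \<circ> l)"
  proof (rule strict_mono_onI)
    fix r s :: real assume rs: "r \<in> {0..1}" "s \<in> {0..1}" "r < s"
    then have "l r < l s" using assms(1) strict_mono_onD unfolding time_changes_def by blast
    then show "(m \<circ> l) r < (m \<circ> l) s"
      using assms(2) time_changesD(1)[OF assms(1)] rs strict_mono_onD unfolding time_changes_def o_def
      by blast
  qed
  ultimately show ?thesis by (simp add: time_changes_def)
qed

lemma time_changes_inv:
  assumes "l \<in> time_changes"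
  shows "inv_into {0..1} l \<in> time_changes"
proof -
  have im: "l ` {0..1} = {0..1}" and mono: "strict_mono_on {0..1} l" and cont: "continuous_on {0..1} l"
    using assms by (auto simp: time_changes_def)
  have inj: "inj_on l {0..1}" using time_changesD(2)[OF assms] .
  have bij: "bij_betw (inv_into {0..1} l) {0..1} {0..1}"
    using inj im by (metis bij_betw_imageI bij_betw_inv_into)
  have "continuous_on (l ` {0..1}) (inv_into {0..1} l)"
    by (rule continuous_on_inv[OF cont]) (use inj in auto)
  moreover have "strict_mono_on {0..1} (inv_into {0..1} l)"
  proof (rule strict_mono_onI)
    fix r s :: real assume rs: "r \<in> {0..1}" "s \<in> {0..1}" "r < s"
    let ?r = "inv_into {0..1} l r" and ?s = "inv_into {0..1} l s"
    have "l ?r = r" "l ?s = s" using rs im by (simp_all add: f_inv_into_f)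
    moreover have "?r \<in> {0..1}" "?s \<in> {0..1}" using rs im by (metis inv_into_into)+
    moreover have "?r \<ge> ?s \<Longrightarrow> l ?r \<ge> l ?s"
      using calculation(3,4) strict_mono_onD[OF mono, of ?s ?r] by (cases "?r = ?s") auto
    ultimately show "?r < ?s" using rs(3) by linarith
  qed
  ultimately show ?thesis using bij im by (auto simp: time_changes_def bij_betw_def)
qed

lemma skorokhod_radii_commute_aux:
  assumes "e \<in> skorokhod_radii x y"
  shows "e \<in> skorokhod_radii y x"
proof -
  obtain l where l: "l \<in> time_changes" "\<And>t. t \<in> {0..1} \<Longrightarrow> \<bar>l t - t\<bar> \<le> e \<and> \<bar>x t - y (l t)\<bar> \<le> e"
    using assms by (auto simp: skorokhod_radii_def)
  have im: "l ` {0..1} = {0..1}" using l by (auto simp: time_changes_def)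
  have "\<bar>inv_into {0..1} l t - t\<bar> \<le> e \<and> \<bar>y t - x (inv_into {0..1} l t)\<bar> \<le> e" if "t \<in> {0..1}" for t
  proof -
    have "l (inv_into {0..1} l t) = t" using that im by (simp add: f_inv_into_f)
    moreover have "inv_into {0..1} l t \<in> {0..1}" using that im by (metis inv_into_into)
    ultimately show ?thesis using l(2)[of "inv_into {0..1} l t"] by (simp add: abs_minus_commute)
  qed
  then show ?thesis using time_changes_inv[OF l(1)] unfolding skorokhod_radii_def by blast
qed

lemma skorokhod_radii_commute: "skorokhod_radii x y = skorokhod_radii y x"
  using skorokhod_radii_commute_aux by blast

lemma skorokhod_radii_nonneg: "e \<in> skorokhod_radii x y \<Longrightarrow> 0 \<le> e"
  unfolding skorokhod_radii_def
  by (smt (verit, best) atLeastAtMost_iff mem_Collect_eq)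

lemma skorokhod_radii_bdd: "bdd_below (skorokhod_radii x y)"
  using skorokhod_radii_nonneg by (rule bdd_belowI)

lemma skorokhod_radii_uniform:
  assumes "x \<in> cadlag" "y \<in> cadlag"
  shows "uniform_dist x y \<in> skorokhod_radii x y"
  using time_changes_id uniform_dist_ge[OF assms] Metric_space.nonneg[OF Metric_space_uniform]
  unfolding skorokhod_radii_def mem_Collect_eq by (intro bexI[of _ "\<lambda>t. t"]) simp_all

lemma skorokhod_dist_le_uniform_dist: "skorokhod_dist x y \<le> uniform_dist x y"
  using cInf_lower[OF skorokhod_radii_uniform skorokhod_radii_bdd]
  by (auto simp: skorokhod_dist_def uniform_dist_def)

lemma skorokhod_dist_lessD:
  assumes "x \<in> cadlag" "y \<in> cadlag" "skorokhod_dist x y < c"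
  obtains e where "e \<in> skorokhod_radii x y" "e < c"
proof -
  have "Inf (skorokhod_radii x y) < c" using assms by (simp add: skorokhod_dist_def)
  moreover have "skorokhod_radii x y \<noteq> {}" using skorokhod_radii_uniform[OF assms(1,2)] by blast
  ultimately show thesis using that cInf_lessD by blast
qed

lemma skorokhod_dist_nonneg: "0 \<le> skorokhod_dist x y"
proof (cases "x \<in> cadlag \<and> y \<in> cadlag")
  case True
  then have "skorokhod_radii x y \<noteq> {}" using skorokhod_radii_uniform by blast
  then have "0 \<le> Inf (skorokhod_radii x y)" using skorokhod_radii_nonneg by (intro cInf_greatest)
  then show ?thesis using True by (simp add: skorokhod_dist_def)
qed (auto simp: skorokhod_dist_def)

lemma skorokhod_dist_eq_0D:
  assumes xy: "x \<in> cadlag" "y \<in> cadlag" and 0: "skorokhod_dist x y = 0"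
  shows "x = y"
proof (rule cadlag_eqI[OF xy], rule ccontr)
  fix t :: real
  assume t: "t \<in> {0..1}" and ne: "x t \<noteq> y t"
  define c where "c = \<bar>x t - y t\<bar>"
  have c: "c > 0" using ne by (simp add: c_def)
  have ex: "\<exists>l\<in>time_changes. \<forall>t\<in>{0..1}. \<bar>l t - t\<bar> < e \<and> \<bar>x t - y (l t)\<bar> < e" if e: "e > 0" for e
  proof -
    obtain e' where "e' \<in> skorokhod_radii x y" "e' < e"
      using skorokhod_dist_lessD[OF xy, of e] 0 e by auto
    then obtain l where "l \<in> time_changes" "\<forall>t\<in>{0..1}. \<bar>l t - t\<bar> \<le> e' \<and> \<bar>x t - y (l t)\<bar> \<le> e'"
      unfolding skorokhod_radii_def by blast
    then show ?thesis using \<open>e' < e\<close> by (meson le_less_trans)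
  qed
  show False
  proof (cases "t = 1")
    case True
    obtain l where l: "l \<in> time_changes" "\<forall>t\<in>{0..1}. \<bar>l t - t\<bar> < c \<and> \<bar>x t - y (l t)\<bar> < c"
      using ex[OF c] by blast
    then have "\<bar>x t - y (l t)\<bar> < c" using t by blast
    then show False using True time_changesD(3)[OF l(1)] by (simp add: c_def)
  next
    case False
    then have t1: "t < 1" using t by simp
    have "(x \<longlongrightarrow> x t) (at_right t)" "(y \<longlongrightarrow> y t) (at_right t)"
      using xy t t1 by (auto simp: cadlag_def)
    then have "eventually (\<lambda>s. dist (x s) (x t) < c/3) (at_right t)"
      and "eventually (\<lambda>s. dist (y s) (y t) < c/3) (at_right t)"
      using c by (simp_all only: tendsto_iff)
    then have "eventually (\<lambda>s. dist (x s) (x t) < c/3 \<and> dist (y s) (y t) < c/3) (at_right t)"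
      by (rule eventually_conj)
    then obtain b where b: "b > t" "\<And>s. t < s \<Longrightarrow> s < b \<Longrightarrow> dist (x s) (x t) < c/3 \<and> dist (y s) (y t) < c/3"
      unfolding eventually_at_right_field by blast
    define d where "d = (min b 1 - t) / 2"
    have d: "d > 0" "t + 2 * d \<le> b" "t + 2 * d \<le> 1" using b(1) t1 by (simp_all add: d_def min_def field_simps)
    obtain l where l: "\<forall>t\<in>{0..1}. \<bar>l t - t\<bar> < min d (c/3) \<and> \<bar>x t - y (l t)\<bar> < min d (c/3)"
      using ex[of "min d (c/3)"] d c by auto
    have s: "t + d \<in> {0..1}" using t d by auto
    have 1: "\<bar>l (t + d) - (t + d)\<bar> < d" "\<bar>x (t + d) - y (l (t + d))\<bar> < c/3" using l s by auto
    have "dist (x (t + d)) (x t) < c/3" using b(2)[of "t + d"] d by auto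
    moreover have "dist (y (l (t + d))) (y t) < c/3" using b(2)[of "l (t + d)"] d 1 by linarith
    moreover have "c \<le> \<bar>x (t + d) - x t\<bar> + \<bar>x (t + d) - y (l (t + d))\<bar> + \<bar>y (l (t + d)) - y t\<bar>"
      unfolding c_def by simp
    ultimately show False using 1(2) unfolding dist_real_def by simp
  qed
qed

lemma Metric_space_skorokhod: "Metric_space cadlag skorokhod_dist"
proof
  fix x y :: "real \<Rightarrow> real"
  show "0 \<le> skorokhod_dist x y"
    by (rule skorokhod_dist_nonneg)
  show "skorokhod_dist x y = skorokhod_dist y x"
    by (auto simp: skorokhod_dist_def skorokhod_radii_commute)
next
  fix x y :: "real \<Rightarrow> real"
  assume xy: "x \<in> cadlag" "y \<in> cadlag"
  have "skorokhod_dist x x = 0"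
  proof (rule antisym)
    show "skorokhod_dist x x \<le> 0"
      using skorokhod_dist_le_uniform_dist[of x x] Metric_space.zero[OF Metric_space_uniform xy(1) xy(1)] by simp
    show "0 \<le> skorokhod_dist x x"
      by (rule skorokhod_dist_nonneg)
  qed
  then show "skorokhod_dist x y = 0 \<longleftrightarrow> x = y"
    using skorokhod_dist_eq_0D[OF xy] by auto
next
  fix x y z :: "real \<Rightarrow> real"
  assume xyz: "x \<in> cadlag" "y \<in> cadlag" "z \<in> cadlag"
  show "skorokhod_dist x z \<le> skorokhod_dist x y + skorokhod_dist y z"
  proof (rule field_le_epsilon)
    fix c :: real assume c: "c > 0"
    obtain e1 where e1: "e1 \<in> skorokhod_radii x y" "e1 < skorokhod_dist x y + c/2"
      using skorokhod_dist_lessD[OF xyz(1,2), of "skorokhod_dist x y + c/2"] c by auto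
    obtain e2 where e2: "e2 \<in> skorokhod_radii y z" "e2 < skorokhod_dist y z + c/2"
      using skorokhod_dist_lessD[OF xyz(2,3), of "skorokhod_dist y z + c/2"] c by auto
    obtain l where l: "l \<in> time_changes" "\<forall>t\<in>{0..1}. \<bar>l t - t\<bar> \<le> e1 \<and> \<bar>x t - y (l t)\<bar> \<le> e1"
      using e1 by (auto simp: skorokhod_radii_def)
    obtain m where m: "m \<in> time_changes" "\<forall>t\<in>{0..1}. \<bar>m t - t\<bar> \<le> e2 \<and> \<bar>y t - z (m t)\<bar> \<le> e2"
      using e2 by (auto simp: skorokhod_radii_def)
    have "\<bar>(m \<circ> l) t - t\<bar> \<le> e1 + e2 \<and> \<bar>x t - z ((m \<circ> l) t)\<bar> \<le> e1 + e2" if t: "t \<in> {0..1}" for t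
    proof -
      have "l t \<in> {0..1}" using time_changesD(1)[OF l(1) t] .
      then have "\<bar>m (l t) - l t\<bar> \<le> e2" "\<bar>y (l t) - z (m (l t))\<bar> \<le> e2" using m(2) by blast+
      moreover have "\<bar>l t - t\<bar> \<le> e1" "\<bar>x t - y (l t)\<bar> \<le> e1" using l(2) t by blast+
      ultimately show ?thesis unfolding o_def by linarith
    qed
    then have "e1 + e2 \<in> skorokhod_radii x z"
      using time_changes_comp[OF l(1) m(1)] unfolding skorokhod_radii_def by blast
    then have "skorokhod_dist x z \<le> e1 + e2"
      using cInf_lower[OF _ skorokhod_radii_bdd] xyz by (auto simp: skorokhod_dist_def)
    then show "skorokhod_dist x z \<le> skorokhod_dist x y + skorokhod_dist y z + c"
      using e1 e2 by linarith
  qed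
qed

section \<open>Convergence in distribution\<close>

definition borel_of :: "'s topology \<Rightarrow> 's measure" where
  "borel_of T = sigma (topspace T) {U. openin T U}"

text \<open>The uniform topology on \<open>D([0,1],\<real>)\<close> is not separable, so Borel measurability of the random
  elements is not automatic from measurability of their coordinates; it is part of the notion.\<close>

definition converges_in_distribution ::
  "'s topology \<Rightarrow> (nat \<Rightarrow> 'a measure) \<Rightarrow> (nat \<Rightarrow> 'a \<Rightarrow> 's) \<Rightarrow> 'b measure \<Rightarrow> ('b \<Rightarrow> 's) \<Rightarrow> bool" where
  "converges_in_distribution T M X N Z \<longleftrightarrow>
     (\<forall>n. X n \<in> measurable (M n) (borel_of T)) \<and> Z \<in> measurable N (borel_of T) \<and>
     (\<forall>f. continuous_map T euclideanreal f \<and> bounded (f ` topspace T) \<longrightarrow>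
        (\<lambda>n. \<integral>\<omega>. f (X n \<omega>) \<partial>M n) \<longlonglongrightarrow> (\<integral>\<omega>. f (Z \<omega>) \<partial>N))"

section \<open>Brownian motion\<close>

text \<open>The case \<open>s = t\<close> is excluded from the Gaussian increments because
  \<^const>\<open>normal_density\<close> with standard deviation \<open>0\<close> is not a density.\<close>

definition standard_brownian_motion :: "'b measure \<Rightarrow> (real \<Rightarrow> 'b \<Rightarrow> real) \<Rightarrow> bool" where
  "standard_brownian_motion N B \<longleftrightarrow>
     prob_space N \<and>
     (\<forall>t\<ge>0. B t \<in> borel_measurable N) \<and>
     (AE \<omega> in N. B 0 \<omega> = 0) \<and>
     (\<forall>s t. 0 \<le> s \<and> s < t \<longrightarrow>
        distributed N lborel (\<lambda>\<omega>. B t \<omega> - B s \<omega>) (normal_density 0 (sqrt (t - s)))) \<and>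
     (\<forall>(k::nat) (\<tau>::nat \<Rightarrow> real). 0 \<le> \<tau> 0 \<and> (\<forall>i<k. \<tau> i \<le> \<tau> (Suc i)) \<longrightarrow>
        prob_space.indep_vars N (\<lambda>_. borel) (\<lambda>i \<omega>. B (\<tau> (Suc i)) \<omega> - B (\<tau> i) \<omega>) {..<k}) \<and>
     (\<forall>\<omega>\<in>space N. continuous_on {0..} (\<lambda>t. B t \<omega>))"

section \<open>The random graph process\<close>

definition bernoulli_edges ::
  "'a measure \<Rightarrow> real \<Rightarrow> nat \<Rightarrow> (nat \<Rightarrow> nat \<Rightarrow> 'a \<Rightarrow> bool) \<Rightarrow> bool" where
  "bernoulli_edges M p n I \<longleftrightarrow>
     prob_space M \<and>
     prob_space.indep_vars M (\<lambda>_. count_space UNIV) (\<lambda>(i, j). I i j) {(i, j). 1 \<le> i \<and> i < j \<and> j \<le> n} \<and>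
     (\<forall>i j. 1 \<le> i \<and> i < j \<and> j \<le> n \<longrightarrow>
        distr M (count_space UNIV) (I i j) = measure_pmf (bernoulli_pmf p))"

definition T_proc :: "nat \<Rightarrow> (nat \<Rightarrow> nat \<Rightarrow> 'a \<Rightarrow> bool) \<Rightarrow> real \<Rightarrow> 'a \<Rightarrow> real" where
  "T_proc n I t \<omega> =
     (of_int \<lfloor>real n * t\<rfloor> - 2) / (real n)\<^sup>2 *
     (\<Sum>(i, j) | 1 \<le> i \<and> i < j \<and> int j \<le> \<lfloor>real n * t\<rfloor>. of_bool (I i j \<omega>))"

definition Y_proc :: "'a measure \<Rightarrow> nat \<Rightarrow> (nat \<Rightarrow> nat \<Rightarrow> 'a \<Rightarrow> bool) \<Rightarrow> 'a \<Rightarrow> real \<Rightarrow> real" where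
  "Y_proc M n I \<omega> = (\<lambda>t\<in>{0..1}. T_proc n I t \<omega> - (\<integral>\<omega>'. T_proc n I t \<omega>' \<partial>M))"

definition Z_proc :: "real \<Rightarrow> (real \<Rightarrow> 'b \<Rightarrow> real) \<Rightarrow> 'b \<Rightarrow> real \<Rightarrow> real" where
  "Z_proc p B \<omega> = (\<lambda>t\<in>{0..1}. sqrt (p * (1 - p) / 2) * t * B (t\<^sup>2) \<omega>)"

end

theory Submission
  imports Defs
begin

text \<open>
  Listing the edges \<open>(i, j)\<close> by increasing \<open>j\<close> turns the edge counts into partial sums \<open>S\<close> of one
  i.i.d. centred Bernoulli sequence evaluated at \<open>m choose 2\<close>, so the path jumps at \<open>m / n\<close> to
  \<open>(m - 2) / n\<^sup>2 * S (m choose 2)\<close>. For a fixed grid \<open>i / k\<close> the increments of \<open>S\<close> between grid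
  points are independent; the central limit theorem together with Skorohod's representation in each
  coordinate separately yields joint convergence to the increments of \<open>B\<close> between \<open>(l / k)\<^sup>2\<close> and
  \<open>((l + 1) / k)\<^sup>2\<close>. An exponential maximal inequality bounds the uniform distance between a path
  and its discretisation to the grid, uniformly in \<open>n\<close>; this handles bounded Lipschitz functionals,
  and inf-convolution extends the convergence to bounded continuous ones. No separability is needed
  since only finitely many coordinates or continuous limit paths ever occur. The Skorokhod topology
  is coarser than the uniform one, so the uniform statement suffices.
\<close>

section \<open>Inf-convolution and weak convergence in metric spaces\<close>


text \<open>The limit has the form t B(t^2) because the two factors of the path value converge
  separately: with m about n t, (m - 2) / n tends to t, while m choose 2 is about n^2 t^2 / 2, so
  that S (m choose 2) / n has limiting variance p (1 - p) t^2 / 2. The obstacle is the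
  discretisation error, which must be controlled in k + 1 cells at once, each with of order n^2 / k
  summands. Kolmogorov's second moment inequality bounds the probability of one bad cell only by a
  multiple of 1 / (\<epsilon>^2 k), which does not vanish after summation over the cells; an
  exponential bound of order exp (- \<epsilon>^2 k) does. Representing each coordinate separately is
  enough because the increments are independent: on the product of the spaces given by Skorohod's
  theorem the joint law is again the product of the marginals. Different n may come with unrelated
  spaces \<open>M n\<close>, but convergence in distribution only sees laws, so one sequence space
  can replace them all.\<close>

context Metric_space
begin

text \<open>The Pasch-Hausdorff envelope: for \<open>h\<close> bounded below on \<open>M\<close> and
  \<open>L \<ge> 0\<close> it is the largest \<open>L\<close>-Lipschitz minorant of
  \<open>h\<close>.\<close>

definition lipschitz_envelope :: "real \<Rightarrow> ('a \<Rightarrow> real) \<Rightarrow> 'a \<Rightarrow> real" where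
  "lipschitz_envelope L h x = (INF y\<in>M. h y + L * d x y)"

lemma lipschitz_envelope_bdd_below:
  assumes "\<And>y. y \<in> M \<Longrightarrow> b \<le> h y" "0 \<le> L"
  shows "bdd_below ((\<lambda>y. h y + L * d x y) ` M)"
  using assms by (intro bdd_belowI2[of _ b]) (simp add: add_increasing2)

lemma lipschitz_envelope_le:
  assumes "\<And>y. y \<in> M \<Longrightarrow> b \<le> h y" "0 \<le> L" "x \<in> M"
  shows "lipschitz_envelope L h x \<le> h x"
proof -
  have "lipschitz_envelope L h x \<le> h x + L * d x x"
    unfolding lipschitz_envelope_def
    by (rule cINF_lower[OF lipschitz_envelope_bdd_below]) (use assms in auto)
  then show ?thesis using assms by simp
qed

text \<open>A competitor \<open>y\<close> inside the ball costs at least \<open>c\<close>; outside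
  it the penalty alone is at least \<open>L * r\<close>. Large \<open>L\<close> therefore makes the
  envelope see only local values of \<open>h\<close>. With \<open>r = 0\<close> the ball is empty,
  which gives the global bound \<open>b\<close>.\<close>

lemma lipschitz_envelope_ge_local:
  assumes "\<And>y. y \<in> M \<Longrightarrow> b \<le> h y" "0 \<le> L" "x \<in> M" "\<And>y. y \<in> mball x r \<Longrightarrow> c \<le> h y"
  shows "min c (b + L * r) \<le> lipschitz_envelope L h x"
  unfolding lipschitz_envelope_def
proof (rule cINF_greatest)
  fix y assume y: "y \<in> M"
  show "min c (b + L * r) \<le> h y + L * d x y"
  proof (cases "d x y < r")
    case True
    then show ?thesis using assms(2,3) assms(4)[of y] y by (simp add: min.coboundedI1 add_increasing2)
  next
    case False
    then have "L * r \<le> L * d x y" using assms(2) by (intro mult_left_mono) auto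
    then show ?thesis using assms(1)[OF y] by linarith
  qed
qed (use assms in auto)

lemma lipschitz_envelope_ge:
  assumes "\<And>y. y \<in> M \<Longrightarrow> b \<le> h y" "0 \<le> L" "x \<in> M"
  shows "b \<le> lipschitz_envelope L h x"
  using lipschitz_envelope_ge_local[OF assms, where r=0 and c=b] assms by simp

lemma lipschitz_envelope_lipschitz:
  assumes "\<And>y. y \<in> M \<Longrightarrow> b \<le> h y" "0 \<le> L" "x \<in> M" "y \<in> M"
  shows "\<bar>lipschitz_envelope L h x - lipschitz_envelope L h y\<bar> \<le> L * d x y"
proof -
  have *: "lipschitz_envelope L h u - L * d u v \<le> lipschitz_envelope L h v" if uv: "u \<in> M" "v \<in> M" for u v
    unfolding lipschitz_envelope_def[of L h v]
  proof (rule cINF_greatest)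
    fix w assume w: "w \<in> M"
    have "lipschitz_envelope L h u \<le> h w + L * d u w"
      unfolding lipschitz_envelope_def
      by (rule cINF_lower[OF lipschitz_envelope_bdd_below]) (use assms w in auto)
    moreover have "L * d u w \<le> L * d u v + L * d v w"
      using triangle[OF uv w] assms(2) by (metis distrib_left mult_left_mono)
    ultimately show "lipschitz_envelope L h u - L * d u v \<le> h w + L * d v w" by linarith
  qed (use uv in auto)
  show ?thesis using *[of x y] *[of y x] assms by (simp add: commute[of y x] abs_le_iff)
qed

lemma lipschitz_continuous_map:
  fixes f :: "'a \<Rightarrow> real"
  assumes "\<And>x y. x \<in> M \<Longrightarrow> y \<in> M \<Longrightarrow> \<bar>f x - f y\<bar> \<le> L * d x y"
  shows "continuous_map mtopology euclideanreal f"
proof -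
  have "continuous_map mtopology Met_TC.mtopology f"
    unfolding metric_continuous_map[OF Met_TC.Metric_space_axioms]
  proof (intro conjI ballI allI impI)
    fix a and \<epsilon> :: real assume a: "a \<in> M" and e: "\<epsilon> > 0"
    show "\<exists>\<delta>>0. \<forall>x. x \<in> M \<and> d a x < \<delta> \<longrightarrow> dist (f a) (f x) < \<epsilon>"
    \<comment> \<open>Dividing by \<open>\<bar>L\<bar> + 1\<close> covers \<open>L = 0\<close> and
      negative \<open>L\<close>.\<close>
    proof (intro exI[of _ "\<epsilon> / (\<bar>L\<bar> + 1)"] conjI allI impI)
      fix x assume x: "x \<in> M \<and> d a x < \<epsilon> / (\<bar>L\<bar> + 1)"
      have "\<bar>f a - f x\<bar> \<le> L * d a x" using assms a x by blast
      also have "\<dots> \<le> (\<bar>L\<bar> + 1) * d a x" by (intro mult_right_mono) auto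
      also have "\<dots> < \<epsilon>" using x by (simp add: field_simps)
      finally show "dist (f a) (f x) < \<epsilon>" by (simp add: dist_real_def)
    qed (use e in \<open>auto intro!: divide_pos_pos add_nonneg_pos\<close>)
  qed auto
  then show ?thesis by (simp add: Met_TC.mtopology_def)
qed

lemma continuous_map_dist_null:
  fixes f :: "'a \<Rightarrow> real"
  assumes "continuous_map mtopology euclideanreal f" "x \<in> M" "eventually (\<lambda>n. X n \<in> M) F"
    and "((\<lambda>n. d (X n) x) \<longlongrightarrow> 0) F"
  shows "((\<lambda>n. f (X n)) \<longlongrightarrow> f x) F"
proof -
  have "limitin mtopology X x F" using assms by (simp add: limitin_metric_dist_null)
  from continuous_map_limit[OF assms(1) this] show ?thesis by (simp add: o_def)
qed

lemma lipschitz_envelope_tendsto: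
  assumes b: "\<And>y. y \<in> M \<Longrightarrow> b \<le> h y" and x: "x \<in> M"
    and cont: "continuous_map mtopology euclideanreal h"
  shows "(\<lambda>m. lipschitz_envelope (real m) h x) \<longlonglongrightarrow> h x"
proof (rule LIMSEQ_I)
  fix \<epsilon> :: real assume e: "\<epsilon> > 0"
  have "openin mtopology {y \<in> topspace mtopology. h y \<in> {h x - \<epsilon> / 2<..}}"
    by (rule openin_continuous_map_preimage[OF cont]) auto
  moreover have "x \<in> {y \<in> topspace mtopology. h y \<in> {h x - \<epsilon> / 2<..}}" using x e by auto
  ultimately obtain r where r: "r > 0" "mball x r \<subseteq> {y \<in> topspace mtopology. h y \<in> {h x - \<epsilon> / 2<..}}"
    unfolding openin_mtopology by blast
  \<comment> \<open>From \<open>m0\<close> on the penalty outside the ball is worth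
    \<open>h x - b\<close>, so the minimum in \<open>lipschitz_envelope_ge_local\<close> is at least
    \<open>h x - \<epsilon> / 2\<close>.\<close>
  obtain m0 :: nat where m0: "(h x - b) / r \<le> real m0" using real_arch_simple by blast
  show "\<exists>m0. \<forall>m\<ge>m0. norm (lipschitz_envelope (real m) h x - h x) < \<epsilon>"
  proof (intro exI[of _ m0] allI impI)
    fix m assume "m \<ge> m0"
    then have "(h x - b) / r \<le> real m" using m0 by linarith
    then have "h x \<le> b + real m * r" using r by (simp add: field_simps)
    moreover have "min (h x - \<epsilon> / 2) (b + real m * r) \<le> lipschitz_envelope (real m) h x"
      by (rule lipschitz_envelope_ge_local) (use b x r in force)+
    moreover have "lipschitz_envelope (real m) h x \<le> h x"
      by (rule lipschitz_envelope_le) (use b x in auto)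
    ultimately show "norm (lipschitz_envelope (real m) h x - h x) < \<epsilon>"
      using e unfolding real_norm_def by linarith
  qed
qed

text \<open>A one-sided estimate suffices. The envelopes of \<open>f\<close> are Lipschitz, bounded
  and below \<open>f\<close>, so the lower limit of the integrals of \<open>f (X n \<omega>)\<close>
  is at least the integral of the m-th envelope at \<open>Z \<omega>\<close>, and this tends to that
  of \<open>f (Z \<omega>)\<close> by dominated convergence in m. Applied to \<open>- f\<close> it
  yields the upper half. Since m is fixed before n grows, no tightness is involved.\<close>

lemma weak_convergence_lipschitzI:
  fixes f :: "'a \<Rightarrow> real"
  assumes prob: "\<And>n. prob_space (A n)" "prob_space N"
    and X: "\<And>n \<omega>. \<omega> \<in> space (A n) \<Longrightarrow> X n \<omega> \<in> M" and Z: "\<And>\<omega>. \<omega> \<in> space N \<Longrightarrow> Z \<omega> \<in> M"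
    and Xm: "\<And>n f. continuous_map mtopology euclideanreal f \<Longrightarrow> (\<lambda>\<omega>. f (X n \<omega>)) \<in> borel_measurable (A n)"
    and Zm: "\<And>f. continuous_map mtopology euclideanreal f \<Longrightarrow> (\<lambda>\<omega>. f (Z \<omega>)) \<in> borel_measurable N"
    and lip: "\<And>f L C. 0 \<le> L \<Longrightarrow> (\<And>x y. x \<in> M \<Longrightarrow> y \<in> M \<Longrightarrow> \<bar>f x - f y\<bar> \<le> L * d x y) \<Longrightarrow>
        (\<And>x. x \<in> M \<Longrightarrow> \<bar>f x\<bar> \<le> C) \<Longrightarrow>
        (\<lambda>n. \<integral>\<omega>. f (X n \<omega>) \<partial>A n) \<longlonglongrightarrow> (\<integral>\<omega>. f (Z \<omega>) \<partial>N)"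
    and f: "continuous_map mtopology euclideanreal f" "\<And>x. x \<in> M \<Longrightarrow> \<bar>f x\<bar> \<le> C"
  shows "(\<lambda>n. \<integral>\<omega>. f (X n \<omega>) \<partial>A n) \<longlonglongrightarrow> (\<integral>\<omega>. f (Z \<omega>) \<partial>N)"
proof -
  interpret A: prob_space "A n" for n by (rule prob)
  interpret N: prob_space N by (rule prob)
  have intX: "integrable (A n) (\<lambda>\<omega>. g (X n \<omega>))"
    if "continuous_map mtopology euclideanreal g" "\<And>x. x \<in> M \<Longrightarrow> \<bar>g x\<bar> \<le> C" for g n
    by (rule A.integrable_const_bound[of _ C]) (use that X Xm in auto)
  have lower: "eventually (\<lambda>n. (\<integral>\<omega>. f (Z \<omega>) \<partial>N) - \<epsilon> < (\<integral>\<omega>. f (X n \<omega>) \<partial>A n)) sequentially"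
    if f: "continuous_map mtopology euclideanreal f" "\<And>x. x \<in> M \<Longrightarrow> \<bar>f x\<bar> \<le> C"
      and e: "\<epsilon> > 0" for f and \<epsilon> :: real
  proof -
    have b: "- C \<le> f y" if "y \<in> M" for y using f(2)[OF that] by linarith
    let ?e = "\<lambda>m. lipschitz_envelope (real m) f"
    have elip: "\<bar>?e m x - ?e m y\<bar> \<le> real m * d x y" if "x \<in> M" "y \<in> M" for m x y
      by (rule lipschitz_envelope_lipschitz) (use b that in auto)
    have econt: "continuous_map mtopology euclideanreal (?e m)" for m
      by (rule lipschitz_continuous_map[OF elip])
    have ele: "?e m x \<le> f x" if "x \<in> M" for m x
      by (rule lipschitz_envelope_le) (use b that in auto)
    have ebd: "\<bar>?e m x\<bar> \<le> C" if "x \<in> M" for m x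
      using ele[OF that, of m] f(2)[OF that] lipschitz_envelope_ge[of "-C" f "real m" x] b that by fastforce
    have "(\<lambda>m. \<integral>\<omega>. ?e m (Z \<omega>) \<partial>N) \<longlonglongrightarrow> (\<integral>\<omega>. f (Z \<omega>) \<partial>N)"
    proof (rule integral_dominated_convergence[where w="\<lambda>_. C"])
      show "AE \<omega> in N. (\<lambda>m. ?e m (Z \<omega>)) \<longlonglongrightarrow> f (Z \<omega>)"
        using b Z f by (intro AE_I2 lipschitz_envelope_tendsto) auto
    qed (use ebd Z Zm econt f in auto)
    then have "eventually (\<lambda>m. (\<integral>\<omega>. f (Z \<omega>) \<partial>N) - \<epsilon> < (\<integral>\<omega>. ?e m (Z \<omega>) \<partial>N)) sequentially"
      using e by (intro order_tendstoD(1)) auto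
    then obtain m where m: "(\<integral>\<omega>. f (Z \<omega>) \<partial>N) - \<epsilon> < (\<integral>\<omega>. ?e m (Z \<omega>) \<partial>N)"
      by (auto simp: eventually_sequentially)
    have "(\<lambda>n. \<integral>\<omega>. ?e m (X n \<omega>) \<partial>A n) \<longlonglongrightarrow> (\<integral>\<omega>. ?e m (Z \<omega>) \<partial>N)"
      by (rule lip[of "real m" _ C]) (use elip ebd in auto)
    then have "eventually (\<lambda>n. (\<integral>\<omega>. f (Z \<omega>) \<partial>N) - \<epsilon> < (\<integral>\<omega>. ?e m (X n \<omega>) \<partial>A n)) sequentially"
      using m by (intro order_tendstoD(1)) auto
    then show ?thesis
    proof eventually_elim
      case (elim n)
      have "(\<integral>\<omega>. ?e m (X n \<omega>) \<partial>A n) \<le> (\<integral>\<omega>. f (X n \<omega>) \<partial>A n)"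
        by (rule integral_mono[OF intX intX]) (use econt ebd f X ele in auto)
      then show ?case using elim by linarith
    qed
  qed
  show ?thesis
  proof (rule LIMSEQ_I)
    fix \<epsilon> :: real assume e: "\<epsilon> > 0"
    have cm: "continuous_map mtopology euclideanreal (\<lambda>x. - f x)"
      using f(1) by (simp add: continuous_map_minus)
    have "eventually (\<lambda>n. (\<integral>\<omega>. f (Z \<omega>) \<partial>N) - \<epsilon> < (\<integral>\<omega>. f (X n \<omega>) \<partial>A n)
        \<and> (\<integral>\<omega>. - f (Z \<omega>) \<partial>N) - \<epsilon> < (\<integral>\<omega>. - f (X n \<omega>) \<partial>A n)) sequentially"
      using lower[OF f e] lower[OF cm _ e] f(2) by (auto intro: eventually_conj)
    then have "eventually (\<lambda>n. norm ((\<integral>\<omega>. f (X n \<omega>) \<partial>A n) - (\<integral>\<omega>. f (Z \<omega>) \<partial>N)) < \<epsilon>) sequentially"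
      by eventually_elim (simp add: abs_less_iff)
    then show "\<exists>no. \<forall>n\<ge>no. norm ((\<integral>\<omega>. f (X n \<omega>) \<partial>A n) - (\<integral>\<omega>. f (Z \<omega>) \<partial>N)) < \<epsilon>"
      by (simp add: eventually_sequentially)
  qed
qed

text \<open>For open \<open>U\<close> the 1-Lipschitz envelope of the indicator of \<open>U\<close>
  is, on \<open>M\<close>, the distance to the complement cut off at 1, and \<open>U\<close> is its
  positivity set. Measurability of all continuous functionals thus gives full Borel measurability,
  without a countable base of the topology.\<close>

lemma measurable_borel_ofI:
  assumes Z: "\<And>\<omega>. \<omega> \<in> space N \<Longrightarrow> Z \<omega> \<in> M"
    and Zm: "\<And>f :: 'a \<Rightarrow> real. continuous_map mtopology euclideanreal f \<Longrightarrow> (\<lambda>\<omega>. f (Z \<omega>)) \<in> borel_measurable N"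
  shows "Z \<in> measurable N (borel_of mtopology)"
  unfolding borel_of_def
proof (rule measurable_measure_of)
  fix U assume "U \<in> {U. openin mtopology U}"
  then have U: "openin mtopology U" by simp
  define e where "e = lipschitz_envelope 1 (indicator U)"
  have "continuous_map mtopology euclideanreal e"
    unfolding e_def
    by (rule lipschitz_continuous_map[of _ 1], rule lipschitz_envelope_lipschitz[of 0]) auto
  then have m: "(\<lambda>\<omega>. e (Z \<omega>)) \<in> borel_measurable N" by (rule Zm)
  have "x \<in> U \<longleftrightarrow> 0 < e x" if x: "x \<in> M" for x
  proof
    assume "x \<in> U"
    then obtain r where r: "r > 0" "mball x r \<subseteq> U" using U unfolding openin_mtopology by blast
    have "min 1 (0 + 1 * r) \<le> e x"
      unfolding e_def by (rule lipschitz_envelope_ge_local) (use x r in \<open>auto simp: indicator_def\<close>)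
    then show "0 < e x" using r by linarith
  next
    assume "0 < e x"
    also have "e x \<le> indicator U x"
      unfolding e_def by (rule lipschitz_envelope_le[of 0]) (use x in auto)
    finally show "x \<in> U" by (simp add: indicator_def split: if_splits)
  qed
  then have "Z -` U \<inter> space N = (\<lambda>\<omega>. e (Z \<omega>)) -` {0<..} \<inter> space N" using Z by auto
  also have "\<dots> \<in> sets N" by (rule measurable_sets[OF m]) auto
  finally show "Z -` U \<inter> space N \<in> sets N" .
qed (use Z in \<open>auto simp: openin_mtopology\<close>)

end

section \<open>Independent families\<close>


text \<open>The joint law of an independent family is the product of its marginals, so the integral
  cannot see the underlying space. This carries the argument to the Skorohod spaces, and from graph
  edges to a sequence of bits.\<close>

lemma integral_indep_vars_eq:
  fixes g :: "('i \<Rightarrow> 'c) \<Rightarrow> real"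
  assumes A: "prob_space A" and B: "prob_space B"
    and X: "prob_space.indep_vars A M' X K" and Y: "prob_space.indep_vars B M' Y K"
    and eq: "\<And>l. l \<in> K \<Longrightarrow> distr A (M' l) (X l) = distr B (M' l) (Y l)"
    and g: "g \<in> borel_measurable (PiM K M')"
  shows "(\<integral>\<omega>. g (\<lambda>l\<in>K. X l \<omega>) \<partial>A) = (\<integral>\<omega>. g (\<lambda>l\<in>K. Y l \<omega>) \<partial>B)"
\<comment> \<open>The characterisation of independence by \<open>PiM\<close> used below is for
  nonempty index sets.\<close>
proof (cases "K = {}")
  case True
  interpret A: prob_space A by fact
  interpret B: prob_space B by fact
  show ?thesis using True by (simp add: restrict_def A.prob_space B.prob_space)
next
  case False
  interpret A: prob_space A by fact
  interpret B: prob_space B by fact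
  have Xm: "\<And>l. l \<in> K \<Longrightarrow> X l \<in> measurable A (M' l)" and Ym: "\<And>l. l \<in> K \<Longrightarrow> Y l \<in> measurable B (M' l)"
    using X Y unfolding A.indep_vars_def B.indep_vars_def by auto
  have "distr A (PiM K M') (\<lambda>\<omega>. \<lambda>l\<in>K. X l \<omega>) = (\<Pi>\<^sub>M l\<in>K. distr A (M' l) (X l))"
    using X A.indep_vars_iff_distr_eq_PiM'[OF False, where X=X and M'=M'] Xm by simp
  also have "\<dots> = (\<Pi>\<^sub>M l\<in>K. distr B (M' l) (Y l))" by (rule PiM_cong) (simp_all add: eq)
  also have "\<dots> = distr B (PiM K M') (\<lambda>\<omega>. \<lambda>l\<in>K. Y l \<omega>)"
    using Y B.indep_vars_iff_distr_eq_PiM'[OF False, where X=Y and M'=M'] Ym by simp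
  finally have d: "distr A (PiM K M') (\<lambda>\<omega>. \<lambda>l\<in>K. X l \<omega>) = distr B (PiM K M') (\<lambda>\<omega>. \<lambda>l\<in>K. Y l \<omega>)" .
  have "(\<integral>\<omega>. g (\<lambda>l\<in>K. X l \<omega>) \<partial>A) = integral\<^sup>L (distr A (PiM K M') (\<lambda>\<omega>. \<lambda>l\<in>K. X l \<omega>)) g"
    by (rule integral_distr[symmetric, OF measurable_restrict[OF Xm] g])
  also have "\<dots> = (\<integral>\<omega>. g (\<lambda>l\<in>K. Y l \<omega>) \<partial>B)"
    unfolding d by (rule integral_distr[OF measurable_restrict[OF Ym] g])
  finally show ?thesis .
qed

text \<open>Coordinatewise sequential continuity is continuity for the product topology, whose Borel
  sets form the product sigma-algebra because the index type is countable.\<close>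

lemma borel_measurable_PiM_sequentially:
  fixes g :: "('i::countable \<Rightarrow> real) \<Rightarrow> real"
  assumes g: "\<And>u v. (\<And>l. l \<in> K \<Longrightarrow> (\<lambda>n. u n l) \<longlonglongrightarrow> v l) \<Longrightarrow> (\<lambda>n. g (u n)) \<longlonglongrightarrow> g v"
  shows "g \<in> borel_measurable (PiM K (\<lambda>_. borel))"
proof -
  define ext where "ext u l = (if l \<in> K then u l else 0)" for u :: "'i \<Rightarrow> real" and l
  have "g u = g (ext u)" for u
  proof -
    \<comment> \<open>On \<open>K\<close> the constant sequence \<open>u\<close> converges to
      \<open>ext u\<close>, so the hypothesis forces \<open>g\<close> to ignore all coordinates
      outside \<open>K\<close>.\<close>
    have "(\<lambda>n::nat. g u) \<longlonglongrightarrow> g (ext u)" by (rule g) (simp add: ext_def)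
    then show ?thesis by (simp add: LIMSEQ_const_iff)
  qed
  then have eq: "g = (\<lambda>u. g (ext u))" by blast
  have "continuous_on UNIV g"
    unfolding continuous_on_sequentially
  proof (intro allI ballI impI, elim conjE)
    fix u :: "nat \<Rightarrow> 'i \<Rightarrow> real" and v assume u: "u \<longlonglongrightarrow> v"
    have "(\<lambda>n. u n l) \<longlonglongrightarrow> v l" for l
    proof -
      have "isCont (\<lambda>f :: 'i \<Rightarrow> real. f l) v"
        by (rule continuous_on_interior[OF continuous_on_product_coordinates]) simp
      then show ?thesis using u by (rule isCont_tendsto_compose)
    qed
    then show "(g \<circ> u) \<longlonglongrightarrow> g v" unfolding o_def by (intro g)
  qed
  then have "g \<in> borel_measurable borel" by (rule borel_measurable_continuous_onI)
  then have gm: "g \<in> borel_measurable (PiM UNIV (\<lambda>_. borel))"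
    using measurable_cong_sets[OF sets_PiM_equal_borel[where 'a='i and 'b=real] refl] by blast
  have "(\<lambda>u. \<lambda>l\<in>UNIV. ext u l) \<in> measurable (PiM K (\<lambda>_. borel)) (PiM UNIV (\<lambda>_. borel))"
  proof (intro measurable_restrict)
    fix l :: 'i
    show "(\<lambda>u. ext u l) \<in> borel_measurable (PiM K (\<lambda>_. borel))"
      unfolding ext_def by (cases "l \<in> K") (auto intro: measurable_component_singleton[where M="\<lambda>_. borel"])
  qed
  then have "ext \<in> measurable (PiM K (\<lambda>_. borel)) (PiM UNIV (\<lambda>_. borel))"
    by (simp add: restrict_UNIV)
  from measurable_compose[OF this gm] show ?thesis by (subst eq)
qed

lemma indep_vars_PiM_components:
  assumes \<Omega>: "\<And>i. i \<in> K \<Longrightarrow> prob_space (\<Omega> i)"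
  shows "prob_space.indep_vars (PiM K \<Omega>) \<Omega> (\<lambda>i \<omega>. \<omega> i) K"
proof -
  interpret P: prob_space "PiM K \<Omega>" by (intro prob_space_PiM \<Omega>)
  show ?thesis
  proof (cases "K = {}")
    case True
    then show ?thesis unfolding P.indep_vars_def P.indep_sets_def by auto
  next
    case False
    have "distr (PiM K \<Omega>) (PiM K \<Omega>) (\<lambda>\<omega>. \<lambda>i\<in>K. \<omega> i) = distr (PiM K \<Omega>) (PiM K \<Omega>) (\<lambda>\<omega>. \<omega>)"
      by (rule distr_cong) (auto simp: space_PiM fun_eq_iff PiE_def extensional_def)
    also have "\<dots> = PiM K (\<lambda>i. distr (PiM K \<Omega>) (\<Omega> i) (\<lambda>\<omega>. \<omega> i))"
      by (simp add: distr_id2) (intro PiM_cong refl distr_PiM_component[symmetric] \<Omega>)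
    finally show ?thesis
      using P.indep_vars_iff_distr_eq_PiM'[OF False, where M'=\<Omega> and X="\<lambda>i \<omega>. \<omega> i"] by auto
  qed
qed

text \<open>A continuous mapping theorem for independent coordinates. Each coordinate gets its own
  space on which convergence holds at every point; on the product of these spaces the joint laws are
  unchanged, and dominated convergence finishes. The function \<open>g n\<close> varies with n
  because the coefficients of the graph process do; the hypothesis on it is continuous convergence
  to \<open>h\<close>.\<close>

lemma integral_indep_vars_tendsto:
  fixes U :: "nat \<Rightarrow> 'i::countable \<Rightarrow> 'a \<Rightarrow> real" and G :: "'i \<Rightarrow> 'b \<Rightarrow> real"
  assumes A: "\<And>n. prob_space (A n)" and B: "prob_space B" and K: "finite K"
    and U: "\<And>n. prob_space.indep_vars (A n) (\<lambda>_. borel) (U n) K"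
    and G: "prob_space.indep_vars B (\<lambda>_. borel) G K"
    and conv: "\<And>l. l \<in> K \<Longrightarrow> weak_conv_m (\<lambda>n. distr (A n) borel (U n l)) (distr B borel (G l))"
    and g: "\<And>u v. (\<And>l. l \<in> K \<Longrightarrow> (\<lambda>n. u n l) \<longlonglongrightarrow> v l) \<Longrightarrow> (\<lambda>n. g n (u n)) \<longlonglongrightarrow> h v"
    and gm: "\<And>n. g n \<in> borel_measurable (PiM K (\<lambda>_. borel))" and hm: "h \<in> borel_measurable (PiM K (\<lambda>_. borel))"
    and bdd: "\<And>n u. \<bar>g n u\<bar> \<le> (C::real)"
  shows "(\<lambda>n. \<integral>\<omega>. g n (\<lambda>l\<in>K. U n l \<omega>) \<partial>A n) \<longlonglongrightarrow> (\<integral>\<omega>. h (\<lambda>l\<in>K. G l \<omega>) \<partial>B)"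
proof -
  interpret A: prob_space "A n" for n by (rule A)
  interpret B: prob_space B by fact
  have Um: "\<And>n l. l \<in> K \<Longrightarrow> U n l \<in> borel_measurable (A n)" and Gm: "\<And>l. l \<in> K \<Longrightarrow> G l \<in> borel_measurable B"
    using U G unfolding A.indep_vars_def B.indep_vars_def by auto
  have Sk: "\<exists>\<Omega> Y_seq Y. prob_space \<Omega> \<and> (\<forall>n. Y_seq n \<in> borel_measurable \<Omega>) \<and>
      (\<forall>n. distr \<Omega> borel (Y_seq n) = distr (A n) borel (U n l)) \<and>
      Y \<in> measurable \<Omega> lborel \<and> distr \<Omega> borel Y = distr B borel (G l) \<and>
      (\<forall>x\<in>space (\<Omega> :: real measure). (\<lambda>n. Y_seq n x) \<longlonglongrightarrow> Y x)" if "l \<in> K" for l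
    by (rule Skorohod) (use that Um Gm conv in \<open>auto intro!: A.real_distribution_distr B.real_distribution_distr\<close>)
  have "\<forall>l. \<exists>\<Omega> Y_seq Y. prob_space (\<Omega> :: real measure) \<and> (l \<in> K \<longrightarrow> (\<forall>n. Y_seq n \<in> borel_measurable \<Omega>) \<and>
      (\<forall>n. distr \<Omega> borel (Y_seq n) = distr (A n) borel (U n l)) \<and>
      Y \<in> borel_measurable \<Omega> \<and> distr \<Omega> borel Y = distr B borel (G l) \<and>
      (\<forall>x\<in>space \<Omega>. (\<lambda>n. Y_seq n x) \<longlonglongrightarrow> Y x))"
  proof (intro allI)
    fix l
    show "\<exists>\<Omega> Y_seq Y. prob_space (\<Omega> :: real measure) \<and> (l \<in> K \<longrightarrow> (\<forall>n. Y_seq n \<in> borel_measurable \<Omega>) \<and>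
      (\<forall>n. distr \<Omega> borel (Y_seq n) = distr (A n) borel (U n l)) \<and>
      Y \<in> borel_measurable \<Omega> \<and> distr \<Omega> borel Y = distr B borel (G l) \<and>
      (\<forall>x\<in>space \<Omega>. (\<lambda>n. Y_seq n x) \<longlonglongrightarrow> Y x))"
    proof (cases "l \<in> K")
      case True
      then show ?thesis using Sk[of l] by simp
    next
      case False
      \<comment> \<open>Outside \<open>K\<close> an arbitrary probability space is supplied, which
        lets the choice below be made for all \<open>l\<close> at once.\<close>
      then show ?thesis using prob_space_return[of 0 "borel :: real measure"] by auto
    qed
  qed
  then obtain \<Omega> :: "'i \<Rightarrow> real measure" and V W where *: "\<forall>l. prob_space (\<Omega> l) \<and> (l \<in> K \<longrightarrow>
      (\<forall>n. V l n \<in> borel_measurable (\<Omega> l)) \<and>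
      (\<forall>n. distr (\<Omega> l) borel (V l n) = distr (A n) borel (U n l)) \<and>
      W l \<in> borel_measurable (\<Omega> l) \<and> distr (\<Omega> l) borel (W l) = distr B borel (G l) \<and>
      (\<forall>x\<in>space (\<Omega> l). (\<lambda>n. V l n x) \<longlonglongrightarrow> W l x))"
    unfolding choice_iff by (elim exE) (rule that)
  have \<Omega>: "\<And>l. prob_space (\<Omega> l)"
    and Vm: "\<And>l n. l \<in> K \<Longrightarrow> V l n \<in> borel_measurable (\<Omega> l)"
    and Vd: "\<And>l n. l \<in> K \<Longrightarrow> distr (\<Omega> l) borel (V l n) = distr (A n) borel (U n l)"
    and Wm: "\<And>l. l \<in> K \<Longrightarrow> W l \<in> borel_measurable (\<Omega> l)"
    and Wd: "\<And>l. l \<in> K \<Longrightarrow> distr (\<Omega> l) borel (W l) = distr B borel (G l)"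
    and VW: "\<And>l x. l \<in> K \<Longrightarrow> x \<in> space (\<Omega> l) \<Longrightarrow> (\<lambda>n. V l n x) \<longlonglongrightarrow> W l x"
    using * by blast+
  interpret P: prob_space "PiM K \<Omega>" by (intro prob_space_PiM \<Omega>)
  have ind: "P.indep_vars \<Omega> (\<lambda>l \<omega>. \<omega> l) K"
    by (intro indep_vars_PiM_components \<Omega>)
  have comp: "distr (PiM K \<Omega>) borel (\<lambda>\<omega>. f (\<omega> l)) = distr (\<Omega> l) borel f" if "l \<in> K" "f \<in> borel_measurable (\<Omega> l)" for l and f :: "real \<Rightarrow> real"
  proof -
    have "distr (PiM K \<Omega>) borel (\<lambda>\<omega>. f (\<omega> l)) = distr (distr (PiM K \<Omega>) (\<Omega> l) (\<lambda>\<omega>. \<omega> l)) borel f"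
      using that by (subst distr_distr) (auto simp: o_def)
    also have "distr (PiM K \<Omega>) (\<Omega> l) (\<lambda>\<omega>. \<omega> l) = \<Omega> l"
      by (intro distr_PiM_component \<Omega> that)
    finally show ?thesis .
  qed
  have Vi: "P.indep_vars (\<lambda>_. borel) (\<lambda>l \<omega>. V l n (\<omega> l)) K" for n
    by (rule P.indep_vars_compose2[OF ind]) (rule Vm)
  have Wi: "P.indep_vars (\<lambda>_. borel) (\<lambda>l \<omega>. W l (\<omega> l)) K"
    by (rule P.indep_vars_compose2[OF ind]) (rule Wm)
  have 1: "(\<integral>\<omega>. g n (\<lambda>l\<in>K. U n l \<omega>) \<partial>A n) = (\<integral>\<omega>. g n (\<lambda>l\<in>K. V l n (\<omega> l)) \<partial>PiM K \<Omega>)" for n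
    by (rule integral_indep_vars_eq[OF A P.prob_space_axioms U Vi _ gm]) (use Vd Vm comp in auto)
  have 2: "(\<integral>\<omega>. h (\<lambda>l\<in>K. G l \<omega>) \<partial>B) = (\<integral>\<omega>. h (\<lambda>l\<in>K. W l (\<omega> l)) \<partial>PiM K \<Omega>)"
    by (rule integral_indep_vars_eq[OF B P.prob_space_axioms G Wi _ hm]) (use Wd Wm comp in auto)
  show ?thesis unfolding 1 2
  proof (rule integral_dominated_convergence[where w="\<lambda>_. C"])
    show "(\<lambda>\<omega>. h (\<lambda>l\<in>K. W l (\<omega> l))) \<in> borel_measurable (PiM K \<Omega>)"
      by (rule measurable_compose[OF measurable_restrict hm])
        (use Wm in \<open>auto intro!: measurable_compose[OF measurable_component_singleton]\<close>)
    show "(\<lambda>\<omega>. g n (\<lambda>l\<in>K. V l n (\<omega> l))) \<in> borel_measurable (PiM K \<Omega>)" for n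
      by (rule measurable_compose[OF measurable_restrict gm])
        (use Vm in \<open>auto intro!: measurable_compose[OF measurable_component_singleton]\<close>)
    show "AE \<omega> in PiM K \<Omega>. (\<lambda>n. g n (\<lambda>l\<in>K. V l n (\<omega> l))) \<longlonglongrightarrow> h (\<lambda>l\<in>K. W l (\<omega> l))"
      by (rule AE_I2, rule g) (use VW in \<open>auto simp: space_PiM PiE_iff\<close>)
  qed (use bdd in auto)
qed

section \<open>Maximal inequalities for sums of bounded independent variables\<close>

context prob_space
begin

text \<open>
  Doob's inequality for the submartingale \<open>exp (\<theta> * S m)\<close>, without martingales: with \<open>A m\<close> the event
  that level \<open>a\<close> is reached by time \<open>m\<close>, the bound
  \<open>exp (\<theta> * a) * prob (A m) \<le> expectation (exp (\<theta> * S m); A m)\<close> is preserved by adding one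
  independent centred summand.
\<close>

lemma exponential_maximal_inequality:
  fixes X :: "nat \<Rightarrow> 'a \<Rightarrow> real"
  assumes X: "indep_vars (\<lambda>_. borel) X UNIV"
    and bdd: "\<And>i \<omega>. \<omega> \<in> space M \<Longrightarrow> \<bar>X i \<omega>\<bar> \<le> b"
    and mean: "\<And>i. expectation (X i) = 0" and \<theta>: "0 \<le> \<theta>"
  shows "exp (\<theta> * a) * prob {\<omega>\<in>space M. \<exists>m\<le>n. a \<le> (\<Sum>i<m. X i \<omega>)} \<le> expectation (\<lambda>\<omega>. exp (\<theta> * (\<Sum>i<n. X i \<omega>)))"
proof -
  have Xm [measurable]: "X i \<in> borel_measurable M" for i
    using X unfolding indep_vars_def by auto
  define S where "S m \<omega> = (\<Sum>i<m. X i \<omega>)" for m \<omega>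
  define A where "A m = {\<omega>\<in>space M. \<exists>j\<le>m. a \<le> S j \<omega>}" for m
  define W where "W m \<omega> = exp (\<theta> * S m \<omega>) * of_bool (\<exists>j\<le>m. a \<le> S j \<omega>)" for m \<omega>
  have W_eq: "W m \<omega> = exp (\<theta> * S m \<omega>) * indicator (A m) \<omega>" if "\<omega> \<in> space M" for m \<omega>
    using that by (auto simp: W_def A_def indicator_def)
  have Sm [measurable]: "S m \<in> borel_measurable M" for m unfolding S_def by measurable
  have Am [measurable]: "A m \<in> sets M" for m unfolding A_def by measurable
  have Wm [measurable]: "W m \<in> borel_measurable M" for m unfolding W_def by measurable
  have Sb: "\<bar>S m \<omega>\<bar> \<le> real m * b" if "\<omega> \<in> space M" for m \<omega>
  proof -
    have "(\<Sum>i<m. \<bar>X i \<omega>\<bar>) \<le> real (card {..<m}) * b"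
      by (rule sum_bounded_above) (rule bdd[OF that])
    then have "(\<Sum>i<m. \<bar>X i \<omega>\<bar>) \<le> real m * b" by simp
    then show ?thesis unfolding S_def by (rule order_trans[OF sum_abs])
  qed
  have expS: "exp (\<theta> * S m \<omega>) \<le> exp (\<theta> * (real m * b))" if "\<omega> \<in> space M" for m \<omega>
    using Sb[OF that, of m] \<theta> by (auto intro!: mult_left_mono)
  have intS: "integrable M (\<lambda>\<omega>. exp (\<theta> * S m \<omega>))" for m
    by (rule integrable_const_bound[of _ "exp (\<theta> * (real m * b))"]) (use expS in auto)
  have intX: "integrable M (X i)" for i
    by (rule integrable_const_bound[of _ b]) (use bdd in auto)
  have intE: "integrable M (\<lambda>\<omega>. exp (\<theta> * X i \<omega>))" for i
    by (rule integrable_const_bound[of _ "exp (\<theta> * b)"]) (use bdd \<theta> in \<open>auto simp: abs_le_iff intro!: mult_left_mono\<close>)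
  have intW: "integrable M (W m)" for m
    by (rule Bochner_Integration.integrable_bound[OF intS[of m]]) (auto simp: W_def indicator_def)
  have indep: "indep_var borel (W m) borel (\<lambda>\<omega>. exp (\<theta> * X m \<omega>))" for m
  proof -
    \<comment> \<open>\<open>G\<close> exhibits \<open>W m\<close> as a measurable function of the
      first \<open>m\<close> variables; hence its independence of \<open>X m\<close>.\<close>
    define G where "G u = exp (\<theta> * (\<Sum>i<m. u i)) * of_bool (\<exists>j\<in>{..m}. a \<le> (\<Sum>i<j. u i))" for u :: "nat \<Rightarrow> real"
    have sm: "(\<lambda>u. \<Sum>i<j. u i :: real) \<in> borel_measurable (PiM {..<m} (\<lambda>_. borel))" if "j \<le> m" for j
    proof (rule borel_measurable_sum[where f="\<lambda>i u. u i"])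
      fix i assume "i \<in> {..<j}"
      then show "(\<lambda>u. u i) \<in> borel_measurable (PiM {..<m} (\<lambda>_. borel))"
        using that by (intro measurable_component_singleton[where M="\<lambda>_. borel"]) auto
    qed
    have p: "Measurable.pred (PiM {..<m} (\<lambda>_. borel)) (\<lambda>u :: nat \<Rightarrow> real. \<exists>j\<in>{..m}. a \<le> (\<Sum>i<j. u i))"
      unfolding pred_def[symmetric]
      by (intro pred_intros_finite(4)) (use sm in \<open>auto simp: pred_def intro!: borel_measurable_le\<close>)
    have "G \<in> borel_measurable (PiM {..<m} (\<lambda>_. borel))"
      unfolding G_def using p sm[of m] by measurable
    then have "indep_var borel (G \<circ> (\<lambda>\<omega>. restrict (\<lambda>i. X i \<omega>) {..<m})) borel
        ((\<lambda>u. exp (\<theta> * u m)) \<circ> (\<lambda>\<omega>. restrict (\<lambda>i. X i \<omega>) {m}))"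
      by (intro indep_var_compose[OF indep_var_restrict[OF X]]) auto
    also have "G \<circ> (\<lambda>\<omega>. restrict (\<lambda>i. X i \<omega>) {..<m}) = (\<lambda>\<omega>. exp (\<theta> * S m \<omega>) * of_bool (\<exists>j\<le>m. a \<le> S j \<omega>))"
      by (auto simp: G_def S_def fun_eq_iff Bex_def intro!: arg_cong[where f=of_bool] ex_cong1)
    also have "((\<lambda>u. exp (\<theta> * u m)) \<circ> (\<lambda>\<omega>. restrict (\<lambda>i. X i \<omega>) {m})) = (\<lambda>\<omega>. exp (\<theta> * X m \<omega>))"
      by auto
    finally show ?thesis unfolding W_def .
  qed
  have step: "expectation (W m) + exp (\<theta> * a) * prob (A (Suc m) - A m) \<le> expectation (W (Suc m))" for m
  proof -
    \<comment> \<open>The submartingale property: zero mean and \<open>1 + x \<le> exp x\<close>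
      make the factor contributed by \<open>X m\<close> at least 1 on average.\<close>
    have "1 = expectation (\<lambda>\<omega>. 1 + \<theta> * X m \<omega>)" using mean intX by (simp add: prob_space)
    also have "\<dots> \<le> expectation (\<lambda>\<omega>. exp (\<theta> * X m \<omega>))"
      using intX intE by (intro integral_mono) (auto simp: exp_ge_add_one_self)
    finally have ge1: "1 \<le> expectation (\<lambda>\<omega>. exp (\<theta> * X m \<omega>))" .
    have "expectation (W m) * 1 \<le> expectation (W m) * expectation (\<lambda>\<omega>. exp (\<theta> * X m \<omega>))"
      by (intro mult_left_mono ge1 integral_nonneg_AE) (auto simp: W_def)
    also have "\<dots> = expectation (\<lambda>\<omega>. W m \<omega> * exp (\<theta> * X m \<omega>))"
      by (rule indep_var_lebesgue_integral[OF indep intW intE, symmetric])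
    finally have 1: "expectation (W m) \<le> expectation (\<lambda>\<omega>. W m \<omega> * exp (\<theta> * X m \<omega>))" by simp
    have int: "integrable M (\<lambda>\<omega>. W m \<omega> * exp (\<theta> * X m \<omega>))"
      by (rule indep_var_integrable[OF indep intW intE])
    have intA: "integrable M (indicat_real (A (Suc m) - A m))"
      by (rule integrable_const_bound[of _ 1]) auto
    have "expectation (\<lambda>\<omega>. W m \<omega> * exp (\<theta> * X m \<omega>)) + exp (\<theta> * a) * prob (A (Suc m) - A m)
        = expectation (\<lambda>\<omega>. W m \<omega> * exp (\<theta> * X m \<omega>) + exp (\<theta> * a) * indicator (A (Suc m) - A m) \<omega>)"
      using int intA by (subst Bochner_Integration.integral_add) auto
    also have "\<dots> \<le> expectation (W (Suc m))"
    proof (rule integral_mono[OF _ intW])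
      fix \<omega> assume \<omega>: "\<omega> \<in> space M"
      show "W m \<omega> * exp (\<theta> * X m \<omega>) + exp (\<theta> * a) * indicator (A (Suc m) - A m) \<omega> \<le> W (Suc m) \<omega>"
      proof (cases "\<omega> \<in> A m")
        case True
        then have "\<omega> \<in> A (Suc m)" by (auto simp: A_def intro: le_SucI)
        then show ?thesis using True \<omega> by (simp add: W_eq S_def exp_add distrib_left)
      next
        case False
        \<comment> \<open>The level is reached for the first time at \<open>Suc m\<close>, so
          \<open>exp (\<theta> * S (Suc m) \<omega>)\<close> alone pays for
          \<open>exp (\<theta> * a)\<close>.\<close>
        have "\<omega> \<in> A (Suc m) \<Longrightarrow> a \<le> S (Suc m) \<omega>" using False by (auto simp: A_def le_Suc_eq)
        then show ?thesis using False \<theta> \<omega> by (auto simp: W_eq indicator_def intro!: mult_left_mono)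
      qed
    qed (use int intA in auto)
    finally show ?thesis using 1 by linarith
  qed
  have "exp (\<theta> * a) * prob (A m) \<le> expectation (W m)" for m
  proof (induction m)
    case 0
    show ?case
    proof (cases "a \<le> 0")
      case True
      then have "A 0 = space M" by (auto simp: A_def S_def)
      moreover have "expectation (W 0) = expectation (\<lambda>_. 1)"
        by (rule Bochner_Integration.integral_cong) (auto simp: W_eq S_def \<open>A 0 = space M\<close>)
      ultimately show ?thesis using True \<theta> by (simp add: prob_space mult_nonneg_nonpos)
    next
      case False
      then have "A 0 = {}" by (auto simp: A_def S_def)
      then show ?thesis by (simp add: W_def integral_nonneg_AE)
    qed
  next
    case (Suc m)
    have "A m \<subseteq> A (Suc m)" by (auto simp: A_def intro: le_SucI)
    then have "prob (A (Suc m)) = prob (A m) + prob (A (Suc m) - A m)"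
      by (simp add: finite_measure_Diff)
    then show ?case using Suc step[of m] by (simp add: distrib_left)
  qed
  also have "expectation (W n) \<le> expectation (\<lambda>\<omega>. exp (\<theta> * S n \<omega>))"
    by (rule integral_mono[OF intW intS]) (auto simp: W_def indicator_def)
  finally show ?thesis unfolding A_def S_def .
qed

text \<open>Independence factorises the moment generating function of the sum, and Hoeffding's lemma
  bounds each factor. The parameter \<theta> stays free because its two later uses want different
  values.\<close>

lemma maximal_hoeffding:
  fixes X :: "nat \<Rightarrow> 'a \<Rightarrow> real"
  assumes X: "indep_vars (\<lambda>_. borel) X UNIV"
    and bdd: "\<And>i \<omega>. \<omega> \<in> space M \<Longrightarrow> X i \<omega> \<in> {c..d}"
    and mean: "\<And>i. expectation (X i) = 0" and \<theta>: "0 < \<theta>"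
  shows "prob {\<omega>\<in>space M. \<exists>m\<le>n. a \<le> (\<Sum>i<m. X i \<omega>)} \<le> exp (\<theta>\<^sup>2 * (d - c)\<^sup>2 / 8 * real n - \<theta> * a)"
proof -
  have Xm [measurable]: "X i \<in> borel_measurable M" for i
    using X unfolding indep_vars_def by auto
  define b where "b = max \<bar>c\<bar> \<bar>d\<bar>"
  have bd: "\<bar>X i \<omega>\<bar> \<le> b" if "\<omega> \<in> space M" for i \<omega>
    using bdd[OF that, of i] by (auto simp: b_def)
  have intE: "integrable M (\<lambda>\<omega>. exp (\<theta> * X i \<omega>))" for i
    by (rule integrable_const_bound[of _ "exp (\<theta> * b)"]) (use bd \<theta> in \<open>auto simp: abs_le_iff intro!: mult_left_mono\<close>)
  have mgf: "expectation (\<lambda>\<omega>. exp (\<theta> * X i \<omega>)) \<le> exp (\<theta>\<^sup>2 * (d - c)\<^sup>2 / 8)" for i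
  proof -
    interpret b: interval_bounded_random_variable M "X i" c d
      by unfold_locales (use bdd in auto)
    have "ennreal (expectation (\<lambda>\<omega>. exp (\<theta> * X i \<omega>))) = (\<integral>\<^sup>+\<omega>. exp (\<theta> * X i \<omega>) \<partial>M)"
      by (rule nn_integral_eq_integral[symmetric]) (use intE in auto)
    also have "\<dots> \<le> ennreal (exp (\<theta>\<^sup>2 * (d - c)\<^sup>2 / 8))"
      by (rule b.Hoeffdings_lemma_nn_integral_0[OF \<theta> mean])
    finally show ?thesis by simp
  qed
  have "exp (\<theta> * a) * prob {\<omega>\<in>space M. \<exists>m\<le>n. a \<le> (\<Sum>i<m. X i \<omega>)}
      \<le> expectation (\<lambda>\<omega>. exp (\<theta> * (\<Sum>i<n. X i \<omega>)))"
    by (rule exponential_maximal_inequality[OF X bd mean]) (use \<theta> in auto)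
  also have "\<dots> = expectation (\<lambda>\<omega>. \<Prod>i<n. exp (\<theta> * X i \<omega>))"
    by (simp add: sum_distrib_left exp_sum)
  also have "\<dots> = (\<Prod>i<n. expectation (\<lambda>\<omega>. exp (\<theta> * X i \<omega>)))"
    by (intro indep_vars_lebesgue_integral intE indep_vars_compose2[OF indep_vars_subset[OF X]]) auto
  also have "\<dots> \<le> (\<Prod>i<n. exp (\<theta>\<^sup>2 * (d - c)\<^sup>2 / 8))"
    by (intro prod_mono conjI mgf integral_nonneg_AE) auto
  also have "\<dots> = exp (\<theta>\<^sup>2 * (d - c)\<^sup>2 / 8 * real n)"
    by (simp add: exp_of_nat2_mult[symmetric])
  finally have "exp (\<theta> * a) * prob {\<omega>\<in>space M. \<exists>m\<le>n. a \<le> (\<Sum>i<m. X i \<omega>)} \<le> exp (\<theta>\<^sup>2 * (d - c)\<^sup>2 / 8 * real n)" .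
  then show ?thesis
    unfolding exp_diff by (simp only: pos_le_divide_eq exp_gt_zero mult.commute)
qed

text \<open>Negation preserves the length of the interval, so both tails obey one bound.\<close>

lemma maximal_hoeffding_abs:
  fixes X :: "nat \<Rightarrow> 'a \<Rightarrow> real"
  assumes X: "indep_vars (\<lambda>_. borel) X UNIV"
    and bdd: "\<And>i \<omega>. \<omega> \<in> space M \<Longrightarrow> X i \<omega> \<in> {c..d}"
    and mean: "\<And>i. expectation (X i) = 0" and \<theta>: "0 < \<theta>"
  shows "prob {\<omega>\<in>space M. \<exists>m\<le>n. a \<le> \<bar>\<Sum>i<m. X i \<omega>\<bar>} \<le> 2 * exp (\<theta>\<^sup>2 * (d - c)\<^sup>2 / 8 * real n - \<theta> * a)"
proof -
  have Xm [measurable]: "X i \<in> borel_measurable M" for i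
    using X unfolding indep_vars_def by auto
  have m: "indep_vars (\<lambda>_. borel) (\<lambda>i \<omega>. - X i \<omega>) UNIV"
    by (rule indep_vars_compose2[OF X]) auto
  have "prob {\<omega>\<in>space M. \<exists>m\<le>n. a \<le> \<bar>\<Sum>i<m. X i \<omega>\<bar>}
      \<le> prob ({\<omega>\<in>space M. \<exists>m\<le>n. a \<le> (\<Sum>i<m. X i \<omega>)} \<union> {\<omega>\<in>space M. \<exists>m\<le>n. a \<le> (\<Sum>i<m. - X i \<omega>)})"
    by (rule finite_measure_mono) (auto simp: sum_negf abs_if split: if_splits)
  also have "\<dots> \<le> prob {\<omega>\<in>space M. \<exists>m\<le>n. a \<le> (\<Sum>i<m. X i \<omega>)} + prob {\<omega>\<in>space M. \<exists>m\<le>n. a \<le> (\<Sum>i<m. - X i \<omega>)}"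
    by (rule measure_Un_le) auto
  also have "\<dots> \<le> exp (\<theta>\<^sup>2 * (d - c)\<^sup>2 / 8 * real n - \<theta> * a) + exp (\<theta>\<^sup>2 * ((-c) - (-d))\<^sup>2 / 8 * real n - \<theta> * a)"
    by (intro add_mono maximal_hoeffding X bdd mean \<theta> m) (use bdd mean in auto)
  finally show ?thesis by simp
qed

text \<open>Both characteristic functions are that of \<open>\<mu>\<close> raised to the number of
  summands.\<close>

lemma distr_sum_eq_card:
  fixes X :: "'i \<Rightarrow> 'a \<Rightarrow> real"
  assumes X: "indep_vars (\<lambda>_. borel) X UNIV" and d: "\<And>i. distr M borel (X i) = \<mu>"
    and "finite A" "finite B" "card A = card B"
  shows "distr M borel (\<lambda>\<omega>. \<Sum>i\<in>A. X i \<omega>) = distr M borel (\<lambda>\<omega>. \<Sum>i\<in>B. X i \<omega>)"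
proof (rule Levy_uniqueness)
  have Xm [measurable]: "X i \<in> borel_measurable M" for i
    using X unfolding indep_vars_def by auto
  show "real_distribution (distr M borel (\<lambda>\<omega>. \<Sum>i\<in>A. X i \<omega>))" "real_distribution (distr M borel (\<lambda>\<omega>. \<Sum>i\<in>B. X i \<omega>))"
    by (auto intro!: real_distribution_distr)
  show "char (distr M borel (\<lambda>\<omega>. \<Sum>i\<in>A. X i \<omega>)) = char (distr M borel (\<lambda>\<omega>. \<Sum>i\<in>B. X i \<omega>))"
    using assms(5) by (intro ext) (simp add: char_distr_sum[OF indep_vars_subset[OF X]] d)
qed

end

section \<open>Step paths\<close>


interpretation unif: Metric_space cadlag uniform_dist
  by (rule Metric_space_uniform)

text \<open>One encoding serves two purposes: with \<open>k = n\<close> it describes the process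
  itself, with fixed \<open>k\<close> its discretisation. For \<open>k \<ge> 1\<close> the last
  value \<open>w k\<close> is attained only at time 1.\<close>

definition step_path :: "nat \<Rightarrow> (nat \<Rightarrow> real) \<Rightarrow> real \<Rightarrow> real" where
  "step_path k w = (\<lambda>t\<in>{0..1}. w (nat \<lfloor>real k * t\<rfloor>))"

lemma step_path_index: "t \<in> {0..1} \<Longrightarrow> nat \<lfloor>real k * t\<rfloor> \<le> k"
  using mult_left_mono[of t 1 "real k"] by (simp add: nat_le_iff floor_le_iff)

lemma continuous_on_imp_cadlag:
  assumes x: "x \<in> extensional {0..1}" and c: "continuous_on {0..1} x"
  shows "x \<in> cadlag"
proof -
  have "(x \<longlongrightarrow> x t) (at_right t)" if t: "t \<in> {0..<1}" for t
  proof -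
    have "continuous_on {t..1} x" using c by (rule continuous_on_subset) (use t in auto)
    then show ?thesis using t by (intro continuous_on_Icc_at_rightD[of _ 1]) auto
  qed
  moreover have "(x \<longlongrightarrow> x t) (at_left t)" if t: "t \<in> {0<..1}" for t
  proof -
    have "continuous_on {0..t} x" using c by (rule continuous_on_subset) (use t in auto)
    then show ?thesis using t by (intro continuous_on_Icc_at_leftD[of 0]) auto
  qed
  ultimately show ?thesis using x unfolding cadlag_def by blast
qed

lemma step_path_cadlag: "step_path k w \<in> cadlag"
proof (cases "k = 0")
  case True
  then have eq: "step_path k w = (\<lambda>t\<in>{0..1}. w 0)" by (auto simp: step_path_def)
  show ?thesis unfolding eq
    by (rule continuous_on_imp_cadlag) (auto intro: continuous_on_eq[of _ "\<lambda>_. w 0"])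
next
  case False
  then have k: "real k > 0" by simp
  have right: "(step_path k w \<longlongrightarrow> step_path k w t) (at_right t)" if t: "t \<in> {0..<1}" for t
  proof (rule tendsto_eventually)
    define b where "b = min 1 ((real_of_int \<lfloor>real k * t\<rfloor> + 1) / real k)"
    have "real k * t < real_of_int \<lfloor>real k * t\<rfloor> + 1" by linarith
    then have b: "t < b" using t k by (simp add: b_def field_simps)
    show "eventually (\<lambda>s. step_path k w s = step_path k w t) (at_right t)"
      unfolding eventually_at_right_field
    proof (intro exI[of _ b] conjI b allI impI)
      fix s assume s: "t < s" "s < b"
      have "real k * t \<le> real k * s" using s k by (intro mult_left_mono) auto
      moreover have "real k * s < real_of_int \<lfloor>real k * t\<rfloor> + 1"
        using s k by (simp add: b_def field_simps)
      ultimately have "\<lfloor>real k * s\<rfloor> = \<lfloor>real k * t\<rfloor>" by linarith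
      moreover have "s \<in> {0..1}" using s t by (simp add: b_def)
      ultimately show "step_path k w s = step_path k w t" using t by (simp add: step_path_def)
    qed
  qed
  have left: "\<exists>l. (step_path k w \<longlongrightarrow> l) (at_left t)" if t: "t \<in> {0<..1}" for t
  proof (intro exI tendsto_eventually)
    \<comment> \<open>Just left of \<open>t\<close> the index is the ceiling of \<open>k * t\<close>
      minus 1, also when \<open>t\<close> is itself a jump time.\<close>
    define b where "b = max 0 ((real_of_int \<lceil>real k * t\<rceil> - 1) / real k)"
    have "real_of_int \<lceil>real k * t\<rceil> - 1 < real k * t" by linarith
    then have b: "b < t" using t k by (simp add: b_def field_simps)
    show "eventually (\<lambda>s. step_path k w s = w (nat (\<lceil>real k * t\<rceil> - 1))) (at_left t)"
      unfolding eventually_at_left_field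
    proof (intro exI[of _ b] conjI b allI impI)
      fix s assume s: "b < s" "s < t"
      have "real k * s < real k * t" using s k by simp
      moreover have "real_of_int \<lceil>real k * t\<rceil> - 1 < real k * s"
        using s k by (simp add: b_def field_simps)
      ultimately have "\<lfloor>real k * s\<rfloor> = \<lceil>real k * t\<rceil> - 1" by linarith
      moreover have "s \<in> {0..1}" using s t by (simp add: b_def)
      ultimately show "step_path k w s = w (nat (\<lceil>real k * t\<rceil> - 1))" by (simp add: step_path_def)
    qed
  qed
  show ?thesis using left right by (simp add: cadlag_def step_path_def)
qed

text \<open>Origin of the index \<open>n * i div k\<close> used throughout: the position of the grid
  point \<open>i / k\<close> on the scale of mesh \<open>1 / n\<close>.\<close>

lemma step_path_at:
  assumes "k \<ge> 1" "i \<le> k"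
  shows "step_path n w (real i / real k) = w (n * i div k)"
proof -
  have "\<lfloor>real n * (real i / real k)\<rfloor> = int (n * i div k)"
    using floor_divide_of_nat_eq[of "n * i" k, where 'a=real] by simp
  then show ?thesis using assms by (simp add: step_path_def)
qed

lemma uniform_dist_step_path_le:
  assumes "\<And>i. i \<le> k \<Longrightarrow> \<bar>u i - v i\<bar> \<le> c"
  shows "uniform_dist (step_path k u) (step_path k v) \<le> c"
  by (rule uniform_dist_le[OF step_path_cadlag step_path_cadlag])
    (use assms step_path_index in \<open>auto simp: step_path_def\<close>)

lemma tendsto_step_path:
  fixes f :: "(real \<Rightarrow> real) \<Rightarrow> real"
  assumes f: "continuous_map uniform_topology euclideanreal f"
    and u: "\<And>i. i \<le> k \<Longrightarrow> (\<lambda>n. u n i) \<longlonglongrightarrow> v i"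
  shows "(\<lambda>n. f (step_path k (u n))) \<longlonglongrightarrow> f (step_path k v)"
proof (rule unif.continuous_map_dist_null[where f=f])
  show "continuous_map unif.mtopology euclideanreal f" using f by (simp add: uniform_topology_def)
  have "(\<lambda>n. \<Sum>i\<le>k. \<bar>u n i - v i\<bar>) \<longlonglongrightarrow> (\<Sum>i\<le>k. \<bar>v i - v i\<bar>)"
    by (intro tendsto_intros u) auto
  then have lim: "(\<lambda>n. \<Sum>i\<le>k. \<bar>u n i - v i\<bar>) \<longlonglongrightarrow> 0" by simp
  show "(\<lambda>n. uniform_dist (step_path k (u n)) (step_path k v)) \<longlonglongrightarrow> 0"
  proof (rule tendsto_sandwich[OF _ _ tendsto_const lim])
    show "eventually (\<lambda>n. uniform_dist (step_path k (u n)) (step_path k v) \<le> (\<Sum>i\<le>k. \<bar>u n i - v i\<bar>)) sequentially"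
      by (intro always_eventually allI uniform_dist_step_path_le member_le_sum) auto
  qed auto
qed (auto simp: step_path_cadlag)

text \<open>A step path depends continuously on its \<open>k + 1\<close> values, so \<open>f\<close>
  of it is a measurable function of finitely many reals even though the uniform topology is not
  separable.\<close>

lemma borel_measurable_step_path:
  fixes f :: "(real \<Rightarrow> real) \<Rightarrow> real"
  assumes f: "continuous_map uniform_topology euclideanreal f"
    and w: "\<And>i. i \<le> k \<Longrightarrow> (\<lambda>\<omega>. w \<omega> i) \<in> borel_measurable M"
  shows "(\<lambda>\<omega>. f (step_path k (w \<omega>))) \<in> borel_measurable M"
proof -
  have fm: "(\<lambda>u. f (step_path k u)) \<in> borel_measurable (PiM {..k} (\<lambda>_. borel))"
    by (intro borel_measurable_PiM_sequentially tendsto_step_path[OF f]) auto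
  have "(\<lambda>\<omega>. f (step_path k (\<lambda>i\<in>{..k}. w \<omega> i))) \<in> borel_measurable M"
    by (rule measurable_compose[OF measurable_restrict fm]) (use w in auto)
  moreover have "step_path k (\<lambda>i\<in>{..k}. u i) = step_path k u" for u
    using step_path_index[of _ k] by (auto simp: step_path_def fun_eq_iff)
  ultimately show ?thesis by simp
qed

text \<open>Uniform continuity on the compact interval. It gives both measurability of functionals
  of the limit process and the passage from the grid to the limit.\<close>

lemma step_path_approx:
  assumes x: "x \<in> cadlag" and c: "continuous_on {0..1} x"
  shows "(\<lambda>k. uniform_dist (step_path k (\<lambda>i. x (real i / real k))) x) \<longlonglongrightarrow> 0"
proof (rule LIMSEQ_I)
  fix \<epsilon> :: real assume e: "\<epsilon> > 0"
  have "uniformly_continuous_on {0..1} x" by (rule compact_uniformly_continuous[OF c]) simp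
  then obtain \<delta> where \<delta>: "\<delta> > 0" "\<And>s t. s \<in> {0..1} \<Longrightarrow> t \<in> {0..1} \<Longrightarrow> dist s t < \<delta> \<Longrightarrow> dist (x s) (x t) < \<epsilon> / 2"
    unfolding uniformly_continuous_on_def using half_gt_zero[OF e] by metis
  obtain k0 :: nat where k0: "1 / \<delta> < real k0" using reals_Archimedean2 by blast
  show "\<exists>k0. \<forall>k\<ge>k0. norm (uniform_dist (step_path k (\<lambda>i. x (real i / real k))) x - 0) < \<epsilon>"
  proof (intro exI[of _ k0] allI impI)
    fix k assume "k \<ge> k0"
    then have "1 / \<delta> < real k" using k0 by linarith
    moreover from this have "0 < real k" using \<delta>(1) by (meson less_trans zero_less_divide_1_iff)
    ultimately have k: "real k > 0" "1 / real k < \<delta>" using \<delta>(1) by (simp_all add: field_simps)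
    have "uniform_dist (step_path k (\<lambda>i. x (real i / real k))) x \<le> \<epsilon> / 2"
    proof (rule uniform_dist_le[OF step_path_cadlag x])
      fix t :: real assume t: "t \<in> {0..1}"
      let ?s = "real (nat \<lfloor>real k * t\<rfloor>) / real k"
      have i: "real (nat \<lfloor>real k * t\<rfloor>) = real_of_int \<lfloor>real k * t\<rfloor>" using t k by simp
      have "?s \<le> 1" using step_path_index[OF t, of k] k by simp
      moreover have "?s \<le> t" using k unfolding i by (simp add: field_simps) 
      moreover have "t < ?s + 1 / real k"
      proof -
        have "real k * t < real_of_int \<lfloor>real k * t\<rfloor> + 1" by linarith
        then show ?thesis unfolding i using k by (simp add: field_simps)
      qed
      ultimately have "dist ?s t < \<delta>" "?s \<in> {0..1}" using k by (auto simp: dist_real_def)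
      then have "dist (x ?s) (x t) < \<epsilon> / 2" using \<delta>(2) t by blast
      then show "\<bar>step_path k (\<lambda>i. x (real i / real k)) t - x t\<bar> \<le> \<epsilon> / 2"
        using t by (simp add: step_path_def dist_real_def)
    qed
    then show "norm (uniform_dist (step_path k (\<lambda>i. x (real i / real k))) x - 0) < \<epsilon>"
      using e by (simp add: unif.nonneg)
  qed
qed

section \<open>Convergence on a grid\<close>


lemma step_path_cong: "(\<And>i. i \<le> k \<Longrightarrow> u i = v i) \<Longrightarrow> step_path k u = step_path k v"
  using step_path_index[of _ k] by (auto simp: step_path_def fun_eq_iff)

lemma real_choose_two: "real (m choose 2) = real m * (real m - 1) / 2"
  by (induction m) (simp_all add: numeral_2_eq_2 field_simps)

lemma choose_two_mono: "m \<le> n \<Longrightarrow> m choose 2 \<le> n choose 2"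
  unfolding choose_two by (intro div_le_mono mult_le_mono) auto

lemma tendsto_knot:
  assumes "k \<ge> 1"
  shows "(\<lambda>n. real (n * i div k) / real n) \<longlonglongrightarrow> real i / real k"
proof (rule tendsto_sandwich)
  have fl: "real (n * i div k) = real_of_int \<lfloor>real n * real i / real k\<rfloor>" for n
    using floor_divide_of_nat_eq[of "n * i" k, where 'a=real] by simp
  have "real n * (real i / real k - 1 / real n) \<le> real (n * i div k)" if "n \<ge> 1" for n
    using that floor_correct[of "real n * real i / real k"] unfolding fl by (simp add: right_diff_distrib)
  then show "eventually (\<lambda>n. real i / real k - 1 / real n \<le> real (n * i div k) / real n) sequentially"
    unfolding eventually_sequentially by (intro exI[of _ 1]) (auto simp: field_simps)
  have "real (n * i div k) \<le> real n * (real i / real k)" for n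
    unfolding fl by simp
  then show "eventually (\<lambda>n. real (n * i div k) / real n \<le> real i / real k) sequentially"
    unfolding eventually_sequentially by (intro exI[of _ 1]) (auto simp: pos_divide_le_eq mult.commute)
  have "(\<lambda>n. real i / real k - 1 / real n) \<longlonglongrightarrow> real i / real k - 0"
    by (intro tendsto_intros lim_1_over_n)
  then show "(\<lambda>n. real i / real k - 1 / real n) \<longlonglongrightarrow> real i / real k" by simp
qed auto

text \<open>Since \<open>m choose 2\<close> behaves like half the square of \<open>m\<close>, the
  number of edges runs on the clock t^2 / 2. This is the source of the time change in
  \<open>B (t\<^sup>2)\<close> and of the factor 1/2 under the root.\<close>

lemma tendsto_block_index:
  assumes "k \<ge> 1"
  shows "(\<lambda>n. real ((n * i div k) choose 2) / (real n)\<^sup>2) \<longlonglongrightarrow> (real i / real k)\<^sup>2 / 2"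
proof -
  have "(\<lambda>n. (real (n * i div k) / real n) * (real (n * i div k) / real n - 1 / real n) / 2)
      \<longlonglongrightarrow> (real i / real k) * (real i / real k - 0) / 2"
    by (intro tendsto_intros tendsto_knot lim_1_over_n assms) auto
  also have "(\<lambda>n. (real (n * i div k) / real n) * (real (n * i div k) / real n - 1 / real n) / 2)
      = (\<lambda>n. real ((n * i div k) choose 2) / (real n)\<^sup>2)"
    by (auto simp: real_choose_two power2_eq_square diff_divide_distrib right_diff_distrib fun_eq_iff)
  finally show ?thesis by (simp add: power2_eq_square)
qed

text \<open>A centred Bernoulli variable lies in \<open>{-p..1-p}\<close>; an interval of length 1
  makes the factor \<open>(d - c)\<^sup>2\<close> in Hoeffding's bound equal to 1.\<close>

locale bounded_iid = prob_space M for M :: "'a measure" +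
  fixes X :: "nat \<Rightarrow> 'a \<Rightarrow> real" and \<mu> :: "real measure" and c \<sigma> :: real
  assumes indep: "indep_vars (\<lambda>_. borel) X UNIV"
    and distr_X: "\<And>i. distr M borel (X i) = \<mu>"
    and mean: "\<And>i. expectation (X i) = 0"
    and second_moment: "\<And>i. expectation (\<lambda>\<omega>. (X i \<omega>)\<^sup>2) = \<sigma>\<^sup>2"
    and \<sigma>_pos: "\<sigma> > 0"
    and bounded: "\<And>i \<omega>. \<omega> \<in> space M \<Longrightarrow> X i \<omega> \<in> {c..c+1}"
begin

lemma X_measurable [measurable]: "X i \<in> borel_measurable M"
  using indep unfolding indep_vars_def by auto

definition S :: "nat \<Rightarrow> 'a \<Rightarrow> real" where
  "S m \<omega> = (\<Sum>i<m. X i \<omega>)"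

lemma S_measurable [measurable]: "S m \<in> borel_measurable M"
  unfolding S_def by measurable

lemma S_diff: "a \<le> b \<Longrightarrow> S b \<omega> - S a \<omega> = (\<Sum>i\<in>{a..<b}. X i \<omega>)"
  unfolding S_def by (simp add: sum_diff_nat_ivl atLeast0LessThan[symmetric])

definition graph_path :: "nat \<Rightarrow> 'a \<Rightarrow> real \<Rightarrow> real" where
  "graph_path n \<omega> = step_path n (\<lambda>m. (real m - 2) / (real n)\<^sup>2 * S (m choose 2) \<omega>)"

lemma weak_conv_normalised_sum:
  "weak_conv_m (\<lambda>n. distr M borel (\<lambda>\<omega>. S n \<omega> / sqrt (real n * \<sigma>\<^sup>2))) std_normal_distribution"
  unfolding S_def
proof (rule central_limit_theorem_zero_mean[OF indep mean \<sigma>_pos _ _ distr_X])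
  show "integrable M (\<lambda>\<omega>. (X n \<omega>)\<^sup>2)" for n
  proof (rule integrable_const_bound[of _ "(max \<bar>c\<bar> \<bar>c+1\<bar>)\<^sup>2"])
    show "AE \<omega> in M. norm ((X n \<omega>)\<^sup>2) \<le> (max \<bar>c\<bar> \<bar>c + 1\<bar>)\<^sup>2"
    proof (rule AE_I2)
      fix \<omega> assume "\<omega> \<in> space M"
      then have "\<bar>X n \<omega>\<bar> \<le> max \<bar>c\<bar> \<bar>c + 1\<bar>" using bounded[of \<omega> n] by auto
      then have "\<bar>X n \<omega>\<bar>\<^sup>2 \<le> (max \<bar>c\<bar> \<bar>c + 1\<bar>)\<^sup>2" by (intro power_mono) auto
      then show "norm ((X n \<omega>)\<^sup>2) \<le> (max \<bar>c\<bar> \<bar>c + 1\<bar>)\<^sup>2" by simp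
    qed
  qed auto
  show "variance (X n) = \<sigma>\<^sup>2" for n using mean second_moment by simp
qed

text \<open>Reduces the central limit theorem for a block to that for an initial segment of the same
  length.\<close>

lemma distr_block:
  assumes "a \<le> b"
  shows "distr M borel (\<lambda>\<omega>. (S b \<omega> - S a \<omega>) / r) = distr M borel (\<lambda>\<omega>. S (b - a) \<omega> / r)"
proof -
  have "distr M borel (\<lambda>\<omega>. (S b \<omega> - S a \<omega>) / r) = distr (distr M borel (\<lambda>\<omega>. \<Sum>i\<in>{a..<b}. X i \<omega>)) borel (\<lambda>x. x / r)"
    unfolding S_diff[OF assms] by (subst distr_distr) (auto simp: o_def)
  also have "distr M borel (\<lambda>\<omega>. \<Sum>i\<in>{a..<b}. X i \<omega>) = distr M borel (\<lambda>\<omega>. \<Sum>i\<in>{..<b-a}. X i \<omega>)"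
    by (rule distr_sum_eq_card[OF indep distr_X]) auto
  also have "distr (distr M borel (\<lambda>\<omega>. \<Sum>i\<in>{..<b-a}. X i \<omega>)) borel (\<lambda>x. x / r) = distr M borel (\<lambda>\<omega>. S (b - a) \<omega> / r)"
    unfolding S_def by (subst distr_distr) (auto simp: o_def)
  finally show ?thesis .
qed

lemma graph_path_at:
  assumes "k \<ge> 1" "i \<le> k"
  shows "graph_path n \<omega> (real i / real k) = (real (n * i div k) - 2) / (real n)\<^sup>2 * S ((n * i div k) choose 2) \<omega>"
  unfolding graph_path_def by (rule step_path_at[OF assms])

lemma borel_measurable_graph_path:
  "continuous_map uniform_topology euclideanreal f \<Longrightarrow> (\<lambda>\<omega>. f (graph_path n \<omega>)) \<in> borel_measurable M"
  unfolding graph_path_def by (intro borel_measurable_step_path) auto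

lemma borel_measurable_graph_path_knots:
  assumes f: "continuous_map uniform_topology euclideanreal f" and k: "k \<ge> 1"
  shows "(\<lambda>\<omega>. f (step_path k (\<lambda>i. graph_path n \<omega> (real i / real k)))) \<in> borel_measurable M"
  using graph_path_at[OF k] by (intro borel_measurable_step_path[OF f]) auto

text \<open>A grid value is a prefactor times a sum of block increments, each a deterministic
  coefficient times a normalised block sum \<open>U n l\<close>. Distinct blocks use disjoint sets
  of summands, hence independence; each \<open>U n l\<close> is asymptotically standard normal; and
  the coefficients \<open>\<alpha>\<close> and \<open>\<gamma>\<close> converge. The family
  \<open>G\<close> is left abstract, to be filled with Brownian increments.\<close>

lemma integral_knots_tendsto:
  fixes f :: "(real \<Rightarrow> real) \<Rightarrow> real" and G :: "nat \<Rightarrow> 'b \<Rightarrow> real"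
  assumes N: "prob_space N" and G: "prob_space.indep_vars N (\<lambda>_. borel) G {..<k}"
    and Gd: "\<And>l. l < k \<Longrightarrow> distr N borel (G l) = std_normal_distribution"
    and f: "continuous_map uniform_topology euclideanreal f" "\<And>x. x \<in> cadlag \<Longrightarrow> \<bar>f x\<bar> \<le> C"
    and k: "k \<ge> 1"
  shows "(\<lambda>n. \<integral>\<omega>. f (step_path k (\<lambda>i. graph_path n \<omega> (real i / real k))) \<partial>M) \<longlonglongrightarrow>
    (\<integral>\<omega>. f (step_path k (\<lambda>i. real i / real k *
        (\<Sum>l<i. sqrt (((real (Suc l) / real k)\<^sup>2 / 2 - (real l / real k)\<^sup>2 / 2) * \<sigma>\<^sup>2) * G l \<omega>))) \<partial>N)"
proof -
  define b where "b n l = (n * l div k) choose 2" for n l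
  define D where "D n l = b n (Suc l) - b n l" for n l
  define U where "U n l \<omega> = (S (b n (Suc l)) \<omega> - S (b n l) \<omega>) / sqrt (real (D n l) * \<sigma>\<^sup>2)" for n l \<omega>
  define \<alpha> where "\<alpha> n i = (real (n * i div k) - 2) / real n" for n i
  define \<gamma> where "\<gamma> n l = sqrt (real (D n l) * \<sigma>\<^sup>2) / real n" for n l
  define \<gamma>' where "\<gamma>' l = sqrt (((real (Suc l) / real k)\<^sup>2 / 2 - (real l / real k)\<^sup>2 / 2) * \<sigma>\<^sup>2)" for l
  define g where "g n u = f (step_path k (\<lambda>i. \<alpha> n i * (\<Sum>l<i. \<gamma> n l * u l)))" for n and u :: "nat \<Rightarrow> real"
  define h where "h u = f (step_path k (\<lambda>i. real i / real k * (\<Sum>l<i. \<gamma>' l * u l)))" for u :: "nat \<Rightarrow> real"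
  have bmono: "b n l \<le> b n l'" if "l \<le> l'" for n l l'
    unfolding b_def using that by (intro choose_two_mono div_le_mono) auto
  have b0: "b n 0 = 0" for n by (simp add: b_def)
  have D: "real (D n l) = real (b n (Suc l)) - real (b n l)" for n l
    unfolding D_def using bmono[of l "Suc l" n] by (simp add: of_nat_diff)
  have \<gamma>U: "\<gamma> n l * U n l \<omega> = (S (b n (Suc l)) \<omega> - S (b n l) \<omega>) / real n" for n l \<omega>
  \<comment> \<open>For small \<open>n\<close> a block may be empty; its increment is then 0 and the
    identity survives.\<close>
  proof (cases "D n l = 0")
    case True
    then have "b n (Suc l) = b n l" using bmono[of l "Suc l" n] by (simp add: D_def)
    then show ?thesis by (simp add: U_def)
  next
    case False
    then show ?thesis using \<sigma>_pos by (simp add: U_def \<gamma>_def)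
  qed
  have path: "step_path k (\<lambda>i. graph_path n \<omega> (real i / real k)) =
      step_path k (\<lambda>i. \<alpha> n i * (\<Sum>l<i. \<gamma> n l * (\<lambda>l\<in>{..<k}. U n l \<omega>) l))" for n \<omega>
  proof (rule step_path_cong)
    fix i assume i: "i \<le> k"
    have "(\<Sum>l<i. \<gamma> n l * (\<lambda>l\<in>{..<k}. U n l \<omega>) l) = (\<Sum>l<i. (S (b n (Suc l)) \<omega> - S (b n l) \<omega>) / real n)"
      using i by (intro sum.cong) (auto simp: \<gamma>U)
    also have "\<dots> = S (b n i) \<omega> / real n"
      using sum_lessThan_telescope[of "\<lambda>l. S (b n l) \<omega>" i]
      by (simp add: sum_divide_distrib[symmetric] b0 S_def[of 0])
    finally show "graph_path n \<omega> (real i / real k) = \<alpha> n i * (\<Sum>l<i. \<gamma> n l * (\<lambda>l\<in>{..<k}. U n l \<omega>) l)"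
      unfolding graph_path_at[OF k i] by (simp add: \<alpha>_def b_def power2_eq_square)
  qed
  have pathG: "step_path k (\<lambda>i. real i / real k * (\<Sum>l<i. \<gamma>' l * G l \<omega>)) =
      step_path k (\<lambda>i. real i / real k * (\<Sum>l<i. \<gamma>' l * (\<lambda>l\<in>{..<k}. G l \<omega>) l))" for \<omega>
    by (intro step_path_cong arg_cong2[where f="(*)"] sum.cong) auto
  have Ui: "indep_vars (\<lambda>_. borel) (U n) {..<k}" for n
  proof -
    have "disjoint_family_on (\<lambda>l. {b n l..<b n (Suc l)}) {..<k}"
      unfolding disjoint_family_on_def
    proof (intro ballI impI)
      fix l l' :: nat assume "l \<noteq> l'"
      then have "Suc l \<le> l' \<or> Suc l' \<le> l" by linarith
      then show "{b n l..<b n (Suc l)} \<inter> {b n l'..<b n (Suc l')} = {}"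
        using bmono[of "Suc l" l' n] bmono[of "Suc l'" l n] by auto
    qed
    then have "indep_vars (\<lambda>l. PiM {b n l..<b n (Suc l)} (\<lambda>_. borel)) (\<lambda>l \<omega>. restrict (\<lambda>i. X i \<omega>) {b n l..<b n (Suc l)}) {..<k}"
      by (intro indep_vars_restrict[OF indep]) auto
    then have "indep_vars (\<lambda>_. borel) (\<lambda>l \<omega>. (\<Sum>i\<in>{b n l..<b n (Suc l)}. restrict (\<lambda>i. X i \<omega>) {b n l..<b n (Suc l)} i) / sqrt (real (D n l) * \<sigma>\<^sup>2)) {..<k}"
      by (rule indep_vars_compose2[where Y="\<lambda>l u. (\<Sum>i\<in>{b n l..<b n (Suc l)}. u i) / sqrt (real (D n l) * \<sigma>\<^sup>2)"])
        (intro borel_measurable_divide borel_measurable_sum measurable_component_singleton borel_measurable_const)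
    then show ?thesis
      unfolding U_def S_diff[OF bmono[OF le_SucI[OF order_refl]]] by simp
  qed
  have \<gamma>lim0: "(\<lambda>n. real (D n l) / (real n)\<^sup>2) \<longlonglongrightarrow> (real (Suc l) / real k)\<^sup>2 / 2 - (real l / real k)\<^sup>2 / 2" for l
    unfolding D diff_divide_distrib b_def by (intro tendsto_diff tendsto_block_index k)
  have \<gamma>lim: "(\<lambda>n. \<gamma> n l) \<longlonglongrightarrow> \<gamma>' l" for l
  proof -
    have "(\<lambda>n. sqrt (real (D n l) / (real n)\<^sup>2 * \<sigma>\<^sup>2)) \<longlonglongrightarrow> \<gamma>' l"
      unfolding \<gamma>'_def by (intro tendsto_intros \<gamma>lim0)
    also have "(\<lambda>n. sqrt (real (D n l) / (real n)\<^sup>2 * \<sigma>\<^sup>2)) = (\<lambda>n. \<gamma> n l)"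
      by (auto simp: \<gamma>_def real_sqrt_mult real_sqrt_divide)
    finally show ?thesis .
  qed
  have \<alpha>lim: "(\<lambda>n. \<alpha> n i) \<longlonglongrightarrow> real i / real k" for i
  proof -
    have "(\<lambda>n. real (n * i div k) / real n - 2 * (1 / real n)) \<longlonglongrightarrow> real i / real k - 2 * 0"
      by (intro tendsto_intros tendsto_knot k lim_1_over_n)
    then show ?thesis by (simp add: \<alpha>_def diff_divide_distrib)
  qed
  \<comment> \<open>The block length grows like \<open>n\<^sup>2\<close> times the limit in
    \<open>\<gamma>lim0\<close>, which is positive.\<close>
  have Dlim: "filterlim (\<lambda>n. D n l) at_top sequentially" for l
  proof -
    have "(real l / real k)\<^sup>2 < (real (Suc l) / real k)\<^sup>2"
      using k by (intro power_strict_mono divide_strict_right_mono) auto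
    then have "filterlim (\<lambda>n. real (D n l) / (real n)\<^sup>2 * (real n)\<^sup>2) at_top sequentially"
      by (intro filterlim_tendsto_pos_mult_at_top[OF \<gamma>lim0] filterlim_pow_at_top filterlim_real_sequentially) auto
    then have "filterlim (\<lambda>n. real (D n l)) at_top sequentially"
      by (rule filterlim_mono_eventually) (auto simp: eventually_sequentially intro!: exI[of _ 1])
    then show ?thesis
      unfolding filterlim_at_top by (metis (mono_tags, lifting) eventually_mono of_nat_le_iff)
  qed
  have conv: "weak_conv_m (\<lambda>n. distr M borel (U n l)) (distr N borel (G l))" if "l \<in> {..<k}" for l
  proof -
    have d: "distr M borel (U n l) = distr M borel (\<lambda>\<omega>. S (D n l) \<omega> / sqrt (real (D n l) * \<sigma>\<^sup>2))" for n
      unfolding U_def D_def by (rule distr_block[OF bmono]) simp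
    have "weak_conv_m (\<lambda>n. distr M borel (\<lambda>\<omega>. S (D n l) \<omega> / sqrt (real (D n l) * \<sigma>\<^sup>2))) std_normal_distribution"
      unfolding weak_conv_m_def weak_conv_def
    proof (intro allI impI)
      fix x assume "isCont (cdf std_normal_distribution) x"
      then have "(\<lambda>n. cdf (distr M borel (\<lambda>\<omega>. S n \<omega> / sqrt (real n * \<sigma>\<^sup>2))) x) \<longlonglongrightarrow> cdf std_normal_distribution x"
        using weak_conv_normalised_sum unfolding weak_conv_m_def weak_conv_def by blast
      \<comment> \<open>The central limit theorem is read along the block lengths, which tend to
        infinity with \<open>n\<close>.\<close>
      from filterlim_compose[OF this Dlim[of l]]
      show "(\<lambda>n. cdf (distr M borel (\<lambda>\<omega>. S (D n l) \<omega> / sqrt (real (D n l) * \<sigma>\<^sup>2))) x) \<longlonglongrightarrow> cdf std_normal_distribution x" .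
    qed
    then show ?thesis using that by (simp add: d Gd)
  qed
  have gm: "g n \<in> borel_measurable (PiM {..<k} (\<lambda>_. borel))" for n
    unfolding g_def by (intro borel_measurable_PiM_sequentially tendsto_step_path f tendsto_intros) auto
  have hm: "h \<in> borel_measurable (PiM {..<k} (\<lambda>_. borel))"
    unfolding h_def by (intro borel_measurable_PiM_sequentially tendsto_step_path f tendsto_intros) auto
  have "(\<lambda>n. \<integral>\<omega>. g n (\<lambda>l\<in>{..<k}. U n l \<omega>) \<partial>M) \<longlonglongrightarrow> (\<integral>\<omega>. h (\<lambda>l\<in>{..<k}. G l \<omega>) \<partial>N)"
  proof (rule integral_indep_vars_tendsto[OF prob_space_axioms N _ Ui G conv _ gm hm])
    fix u :: "nat \<Rightarrow> nat \<Rightarrow> real" and v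
    assume u: "\<And>l. l \<in> {..<k} \<Longrightarrow> (\<lambda>n. u n l) \<longlonglongrightarrow> v l"
    show "(\<lambda>n. g n (u n)) \<longlonglongrightarrow> h v"
      unfolding g_def h_def
      by (intro tendsto_step_path f tendsto_mult \<alpha>lim tendsto_sum \<gamma>lim u) auto
  qed (auto simp: g_def intro!: f(2) step_path_cadlag)
  then show ?thesis unfolding g_def h_def path[symmetric] pathG[symmetric] unfolding \<gamma>'_def .
qed

end

section \<open>Discretisation error and the limit process\<close>


context bounded_iid
begin

text \<open>The good event for the discretisation. For \<open>k \<le> n\<close> at most
  \<open>2 * n * n div k\<close> edges are added between a grid point and any time in its cell,
  hence the range of \<open>j\<close> in the first clause; \<open>n * n\<close> dominates every
  \<open>m choose 2\<close> with \<open>m \<le> n\<close>. The second threshold may be larger by the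
  factor \<open>k\<close> because there \<open>S\<close> is multiplied by a change of the prefactor
  of order 1 / (n k).\<close>

definition regular :: "nat \<Rightarrow> nat \<Rightarrow> real \<Rightarrow> 'a \<Rightarrow> bool" where
  "regular n k \<epsilon> \<omega> \<longleftrightarrow>
    (\<forall>i\<le>k. \<forall>j\<le>2 * n * n div k. \<bar>S (((n * i div k) choose 2) + j) \<omega> - S ((n * i div k) choose 2) \<omega>\<bar> < \<epsilon> * real n) \<and>
    (\<forall>j\<le>n * n. \<bar>S j \<omega>\<bar> < \<epsilon> * real k * real n)"

lemma uniform_dist_knots_le:
  assumes k: "1 \<le> k" "k \<le> n" and \<epsilon>: "0 < \<epsilon>" and reg: "regular n k \<epsilon> \<omega>"
  shows "uniform_dist (graph_path n \<omega>) (step_path k (\<lambda>i. graph_path n \<omega> (real i / real k))) \<le> 4 * \<epsilon>"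
  unfolding graph_path_def[of n \<omega>]
proof (rule uniform_dist_le[OF step_path_cadlag step_path_cadlag])
  fix t :: real assume t: "t \<in> {0..1}"
  define i where "i = nat \<lfloor>real k * t\<rfloor>"
  define m where "m = nat \<lfloor>real n * t\<rfloor>"
  define m' where "m' = n * i div k"
  have n: "1 \<le> n" using k by simp
  have ik: "i \<le> k" and mn: "m \<le> n" using step_path_index[OF t] by (auto simp: i_def m_def)
  have i: "real i \<le> real k * t" "real k * t < real i + 1"
    using t unfolding i_def by (auto simp: of_nat_nat)
  have m: "real m \<le> real n * t" "real n * t < real m + 1"
    using t unfolding m_def by (auto simp: of_nat_nat)
  have m': "real m' \<le> real n * real i / real k" "real n * real i / real k < real m' + 1"
    using floor_divide_of_nat_eq[of "n * i" k, where 'a=real] floor_correct[of "real n * real i / real k"]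
    unfolding m'_def by auto
  have "real n * real i / real k \<le> real n * t"
    using i(1) k n by (simp add: field_simps)
  then have "real m' < real m + 1" using m m' by linarith
  then have m'm: "m' \<le> m" by simp
  have "real n * t < real n * real i / real k + real n / real k"
  proof -
    have "real n * (real k * t) < real n * (real i + 1)" using i(2) n by simp
    then show ?thesis using k by (simp add: field_simps)
  qed
  then have "real m - real m' < real n / real k + 1" using m m' by linarith
  \<comment> \<open>Rounding costs at most one index, which is absorbed here; this is where
    \<open>k \<le> n\<close> enters.\<close>
  moreover have "1 \<le> real n / real k" using k by simp
  ultimately have gap: "real m - real m' \<le> 2 * real n / real k" and gap': "real m - real m' \<le> real n / real k + 1" by simp_all
  define j where "j = (m choose 2) - (m' choose 2)"
  have j: "m choose 2 = (m' choose 2) + j" using choose_two_mono[OF m'm] by (simp add: j_def)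
  \<comment> \<open>The difference of the two binomials, factorised; the sum factor is below
    \<open>2 * n\<close>.\<close>
  have "real j = (real m - real m') * (real m + real m' - 1) / 2"
    using arg_cong[OF j, of real] by (simp add: real_choose_two field_simps)
  also have "\<dots> \<le> (real m - real m') * (2 * real n) / 2"
    using m'm mn by (intro divide_right_mono mult_left_mono) auto
  also have "\<dots> \<le> (2 * real n / real k) * (2 * real n) / 2"
    using gap by (intro divide_right_mono mult_right_mono) auto
  also have "\<dots> = 2 * real n * real n / real k" by simp
  finally have "real j * real k \<le> 2 * real n * real n" using k by (simp add: field_simps)
  then have "j * k \<le> 2 * n * n" by (metis (mono_tags) of_nat_le_iff of_nat_mult of_nat_numeral)
  then have jk: "j \<le> 2 * n * n div k" using k by (simp add: less_eq_div_iff_mult_less_eq)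
  have m'n: "m' choose 2 \<le> n * n"
  proof -
    have "m' choose 2 \<le> m' * m'" unfolding choose_two by (metis diff_le_self div_le_dividend le_trans mult_le_mono2)
    also have "\<dots> \<le> n * n" using m'm mn by (intro mult_le_mono) auto
    finally show ?thesis .
  qed
  let ?a = "(real m - 2) / (real n)\<^sup>2" and ?a' = "(real m' - 2) / (real n)\<^sup>2"
  let ?s = "S (m choose 2) \<omega>" and ?s' = "S (m' choose 2) \<omega>"
  have s: "\<bar>?s - ?s'\<bar> \<le> \<epsilon> * real n" and s': "\<bar>?s'\<bar> \<le> \<epsilon> * real k * real n"
    using reg ik jk m'n unfolding regular_def j m'_def by (auto intro: less_imp_le)
  have a: "\<bar>?a\<bar> \<le> 2 / real n"
  proof -
    \<comment> \<open>The factor 2 is forced by \<open>n = 1\<close>, \<open>m = 0\<close>.\<close>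
    have "\<bar>real m - 2\<bar> \<le> 2 * real n" using mn n by linarith
    then show ?thesis using n by (simp add: abs_divide power2_eq_square field_simps)
  qed
  have a': "\<bar>?a - ?a'\<bar> \<le> 2 / (real n * real k)"
  proof -
    have "\<bar>?a - ?a'\<bar> = (real m - real m') / (real n)\<^sup>2" using m'm by (simp add: diff_divide_distrib[symmetric])
    also have "\<dots> \<le> (2 * real n / real k) / (real n)\<^sup>2" using gap by (intro divide_right_mono) auto
    also have "\<dots> = 2 / (real n * real k)" using n by (simp add: power2_eq_square)
    finally show ?thesis .
  qed
  \<comment> \<open>Fluctuation of \<open>S\<close> inside the cell plus change of the prefactor;
    each term contributes \<open>2 * \<epsilon>\<close>.\<close>
  have "\<bar>?a * ?s - ?a' * ?s'\<bar> = \<bar>?a * (?s - ?s') + (?a - ?a') * ?s'\<bar>" by (simp add: algebra_simps)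
  also have "\<dots> \<le> \<bar>?a\<bar> * \<bar>?s - ?s'\<bar> + \<bar>?a - ?a'\<bar> * \<bar>?s'\<bar>"
    using abs_triangle_ineq[of "?a * (?s - ?s')" "(?a - ?a') * ?s'"] unfolding abs_mult .
  also have "\<dots> \<le> (2 / real n) * (\<epsilon> * real n) + (2 / (real n * real k)) * (\<epsilon> * real k * real n)"
    by (intro add_mono mult_mono a a' s s') auto
  also have "\<dots> = 4 * \<epsilon>" using n k by simp
  finally have "\<bar>?a * ?s - ?a' * ?s'\<bar> \<le> 4 * \<epsilon>" .
  moreover have "step_path n (\<lambda>m. (real m - 2) / (real n)\<^sup>2 * S (m choose 2) \<omega>) t = ?a * ?s"
    using t by (simp add: step_path_def m_def)
  moreover have "step_path k (\<lambda>i. step_path n (\<lambda>m. (real m - 2) / (real n)\<^sup>2 * S (m choose 2) \<omega>) (real i / real k)) t = ?a' * ?s'"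
    using t graph_path_at[OF k(1) ik, of n \<omega>] unfolding graph_path_def
    by (simp add: step_path_def[of k] i_def m'_def)
  ultimately show "\<bar>step_path n (\<lambda>m. (real m - 2) / (real n)\<^sup>2 * S (m choose 2) \<omega>) t -
      step_path k (\<lambda>i. step_path n (\<lambda>m. (real m - 2) / (real n)\<^sup>2 * S (m choose 2) \<omega>) (real i / real k)) t\<bar> \<le> 4 * \<epsilon>"
    by simp
qed

lemma prob_block_maximum:
  assumes "0 < \<theta>"
  shows "prob {\<omega>\<in>space M. \<exists>j\<le>D. a \<le> \<bar>S (b + j) \<omega> - S b \<omega>\<bar>} \<le> 2 * exp (\<theta>\<^sup>2 / 8 * real D - \<theta> * a)"
proof -
  \<comment> \<open>The shift by \<open>b\<close> is obtained from disjoint singleton blocks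
    followed by evaluation.\<close>
  have "indep_vars (\<lambda>l. PiM {b + l} (\<lambda>_. borel)) (\<lambda>l \<omega>. restrict (\<lambda>i. X i \<omega>) {b + l}) UNIV"
    by (intro indep_vars_restrict[OF indep]) (auto simp: disjoint_family_on_def)
  then have "indep_vars (\<lambda>_. borel) (\<lambda>l \<omega>. restrict (\<lambda>i. X i \<omega>) {b + l} (b + l)) UNIV"
    by (rule indep_vars_compose2[where Y="\<lambda>l u. u (b + l)"]) (auto intro: measurable_component_singleton)
  then have ind: "indep_vars (\<lambda>_. borel) (\<lambda>l. X (b + l)) UNIV" by simp
  have "S (b + j) \<omega> - S b \<omega> = (\<Sum>l<j. X (b + l) \<omega>)" for j \<omega>
    by (induction j) (auto simp: S_def)
  then show ?thesis
    using maximal_hoeffding_abs[OF ind, of c "c + 1" \<theta> D a] bounded mean assms by auto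
qed

lemma regular_sets [measurable]: "{\<omega>\<in>space M. regular n k \<epsilon> \<omega>} \<in> sets M"
  unfolding regular_def by measurable

text \<open>A union bound over the \<open>k + 1\<close> grid points and the global bound on
  \<open>S\<close>. The estimate is free of \<open>n\<close>, and its exponential decay in
  \<open>k\<close> beats the factor \<open>k + 1\<close>.\<close>

lemma prob_not_regular:
  assumes k: "1 \<le> k" "k \<le> n" and \<epsilon>: "0 < \<epsilon>"
  shows "prob {\<omega>\<in>space M. \<not> regular n k \<epsilon> \<omega>} \<le> 2 * (real k + 1) * exp (- (\<epsilon>\<^sup>2 * real k)) + 2 * exp (1 / 8 - \<epsilon> * real k)"
proof -
  have n: "1 \<le> n" using k by simp
  define F where "F i = {\<omega>\<in>space M. \<exists>j\<le>2 * n * n div k. \<epsilon> * real n \<le> \<bar>S (((n * i div k) choose 2) + j) \<omega> - S ((n * i div k) choose 2) \<omega>\<bar>}" for i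
  \<comment> \<open>Written with \<open>0 + j\<close> and \<open>S 0\<close> to match
    \<open>prob_block_maximum\<close> at \<open>b = 0\<close>.\<close>
  define G where "G = {\<omega>\<in>space M. \<exists>j\<le>n * n. \<epsilon> * real k * real n \<le> \<bar>S (0 + j) \<omega> - S 0 \<omega>\<bar>}"
  have sets: "F i \<in> sets M" "G \<in> sets M" for i unfolding F_def G_def by measurable
  have F: "prob (F i) \<le> 2 * exp (- (\<epsilon>\<^sup>2 * real k))" for i
  proof -
    \<comment> \<open>Minimises \<open>\<theta>\<^sup>2 * n\<^sup>2 / (4 * k) - \<theta> *
      \<epsilon> * n\<close>, the exponent for block length \<open>2 * n\<^sup>2 / k\<close>; the
      minimum is \<open>- (\<epsilon>\<^sup>2 * k)\<close>.\<close>
    define \<theta> where "\<theta> = 2 * \<epsilon> * real k / real n"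
    have "real (2 * n * n div k) \<le> real (2 * n * n) / real k"
      using floor_divide_of_nat_eq[of "2 * n * n" k, where 'a=real] of_int_floor_le[of "real (2 * n * n) / real k"]
      by simp
    then have "\<theta>\<^sup>2 / 8 * real (2 * n * n div k) \<le> \<theta>\<^sup>2 / 8 * (real (2 * n * n) / real k)"
      by (intro mult_left_mono) auto
    also have "\<dots> = \<epsilon>\<^sup>2 * real k" using k n by (simp add: \<theta>_def power2_eq_square field_simps)
    finally have "\<theta>\<^sup>2 / 8 * real (2 * n * n div k) \<le> \<epsilon>\<^sup>2 * real k" .
    moreover have "\<theta> * (\<epsilon> * real n) = 2 * (\<epsilon>\<^sup>2 * real k)" using n by (simp add: \<theta>_def power2_eq_square)
    ultimately have "\<theta>\<^sup>2 / 8 * real (2 * n * n div k) - \<theta> * (\<epsilon> * real n) \<le> - (\<epsilon>\<^sup>2 * real k)" by linarith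
    moreover have "\<theta> > 0" using \<epsilon> k n by (simp add: \<theta>_def)
    ultimately show ?thesis unfolding F_def by (intro order_trans[OF prob_block_maximum[of \<theta>]]) auto
  qed
  have G: "prob G \<le> 2 * exp (1 / 8 - \<epsilon> * real k)"
  proof -
    \<comment> \<open>Here \<open>\<theta> = 1 / n\<close> is good enough: the \<open>n * n\<close>
      summands cost only the constant 1/8.\<close>
    have "prob G \<le> 2 * exp ((1 / real n)\<^sup>2 / 8 * real (n * n) - 1 / real n * (\<epsilon> * real k * real n))"
      unfolding G_def by (rule prob_block_maximum) (use n in auto)
    also have "(1 / real n)\<^sup>2 / 8 * real (n * n) - 1 / real n * (\<epsilon> * real k * real n) = 1 / 8 - \<epsilon> * real k"
      using n by (simp add: power2_eq_square)
    finally show ?thesis .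
  qed
  have "{\<omega>\<in>space M. \<not> regular n k \<epsilon> \<omega>} \<subseteq> (\<Union>i\<in>{..k}. F i) \<union> G"
    by (auto simp: regular_def F_def G_def not_less S_def[of 0])
  then have "prob {\<omega>\<in>space M. \<not> regular n k \<epsilon> \<omega>} \<le> prob ((\<Union>i\<in>{..k}. F i) \<union> G)"
    using sets by (intro finite_measure_mono) auto
  also have "\<dots> \<le> prob (\<Union>i\<in>{..k}. F i) + prob G" using sets by (intro measure_Un_le) auto
  also have "prob (\<Union>i\<in>{..k}. F i) \<le> (\<Sum>i\<in>{..k}. prob (F i))"
    using sets by (intro measure_UNION_le) auto
  also have "\<dots> \<le> (\<Sum>i\<in>{..k}. 2 * exp (- (\<epsilon>\<^sup>2 * real k)))" by (intro sum_mono F)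
  finally show ?thesis using G by (simp add: algebra_simps)
qed

text \<open>On the good event the Lipschitz bound applies, off it the trivial bound
  \<open>2 * C\<close>. The right-hand side does not mention \<open>n\<close>, so \<open>k\<close>
  can be fixed before \<open>n\<close> grows.\<close>

lemma integral_knots_approx:
  fixes f :: "(real \<Rightarrow> real) \<Rightarrow> real"
  assumes k: "1 \<le> k" "k \<le> n" and \<epsilon>: "0 < \<epsilon>" and L: "0 \<le> L"
    and lip: "\<And>x y. x \<in> cadlag \<Longrightarrow> y \<in> cadlag \<Longrightarrow> \<bar>f x - f y\<bar> \<le> L * uniform_dist x y"
    and C: "\<And>x. x \<in> cadlag \<Longrightarrow> \<bar>f x\<bar> \<le> C"
  shows "\<bar>(\<integral>\<omega>. f (graph_path n \<omega>) \<partial>M) - (\<integral>\<omega>. f (step_path k (\<lambda>i. graph_path n \<omega> (real i / real k))) \<partial>M)\<bar>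
    \<le> L * (4 * \<epsilon>) + 2 * C * (2 * (real k + 1) * exp (- (\<epsilon>\<^sup>2 * real k)) + 2 * exp (1 / 8 - \<epsilon> * real k))"
proof -
  have f: "continuous_map uniform_topology euclideanreal f"
    unfolding uniform_topology_def by (rule unif.lipschitz_continuous_map[OF lip])
  let ?W = "\<lambda>\<omega>. f (graph_path n \<omega>)" and ?V = "\<lambda>\<omega>. f (step_path k (\<lambda>i. graph_path n \<omega> (real i / real k)))"
  let ?R = "{\<omega>\<in>space M. \<not> regular n k \<epsilon> \<omega>}"
  have cad: "graph_path n \<omega> \<in> cadlag" for \<omega> unfolding graph_path_def by (rule step_path_cadlag)
  have [measurable]: "?W \<in> borel_measurable M" "?V \<in> borel_measurable M"
    by (rule borel_measurable_graph_path[OF f], rule borel_measurable_graph_path_knots[OF f k(1)])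
  have Rs [measurable]: "?R \<in> sets M" by measurable
  have int: "integrable M ?W" "integrable M ?V"
    by (rule integrable_const_bound[of _ C]; use C cad step_path_cadlag in auto)+
  have intR: "integrable M (indicat_real ?R)"
    by (rule integrable_const_bound[of _ 1]) auto
  have C0: "0 \<le> C" using C[OF step_path_cadlag[of 0 "\<lambda>_. 0"]] by linarith
  have "\<bar>integral\<^sup>L M ?W - integral\<^sup>L M ?V\<bar> = \<bar>\<integral>\<omega>. ?W \<omega> - ?V \<omega> \<partial>M\<bar>"
    using int by simp
  also have "\<dots> \<le> (\<integral>\<omega>. \<bar>?W \<omega> - ?V \<omega>\<bar> \<partial>M)" by (rule integral_abs_bound)
  also have "\<dots> \<le> (\<integral>\<omega>. L * (4 * \<epsilon>) + 2 * C * indicat_real ?R \<omega> \<partial>M)"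
  proof (rule integral_mono)
    fix \<omega> assume \<omega>: "\<omega> \<in> space M"
    show "\<bar>?W \<omega> - ?V \<omega>\<bar> \<le> L * (4 * \<epsilon>) + 2 * C * indicat_real ?R \<omega>"
    proof (cases "regular n k \<epsilon> \<omega>")
      case True
      have "\<bar>?W \<omega> - ?V \<omega>\<bar> \<le> L * uniform_dist (graph_path n \<omega>) (step_path k (\<lambda>i. graph_path n \<omega> (real i / real k)))"
        by (rule lip[OF cad step_path_cadlag])
      also have "\<dots> \<le> L * (4 * \<epsilon>)" by (intro mult_left_mono uniform_dist_knots_le k \<epsilon> True L)
      finally show ?thesis using True by simp
    next
      case False
      have "\<bar>?W \<omega> - ?V \<omega>\<bar> \<le> 2 * C"
        using C[OF cad[of \<omega>]] C[OF step_path_cadlag[of k "\<lambda>i. graph_path n \<omega> (real i / real k)"]] by linarith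
      then show ?thesis using False \<omega> L \<epsilon> by (simp add: add_increasing)
    qed
  qed (use int intR in auto)
  also have "\<dots> = L * (4 * \<epsilon>) + 2 * C * prob ?R"
    using intR by (simp add: prob_space)
  also have "\<dots> \<le> L * (4 * \<epsilon>) + 2 * C * (2 * (real k + 1) * exp (- (\<epsilon>\<^sup>2 * real k)) + 2 * exp (1 / 8 - \<epsilon> * real k))"
    using C0 by (intro add_left_mono mult_left_mono prob_not_regular k \<epsilon>) auto
  finally show ?thesis .
qed

end

section \<open>The Brownian limit: regularity, measurability and values on the grid\<close>

lemma Z_proc_cadlag:
  assumes B: "standard_brownian_motion N B" and \<omega>: "\<omega> \<in> space N"
  shows "Z_proc p B \<omega> \<in> cadlag" "continuous_on {0..1} (Z_proc p B \<omega>)"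
proof -
  have "continuous_on {0..} (\<lambda>t. B t \<omega>)" using B \<omega> by (simp add: standard_brownian_motion_def)
  then have "continuous_on {0..1} (\<lambda>t. B (t\<^sup>2) \<omega>)"
    by (rule continuous_on_compose2) (auto intro!: continuous_intros)
  then have "continuous_on {0..1} (\<lambda>t. sqrt (p * (1 - p) / 2) * t * B (t\<^sup>2) \<omega>)"
    by (intro continuous_intros)
  then show c: "continuous_on {0..1} (Z_proc p B \<omega>)"
    by (rule continuous_on_eq) (simp add: Z_proc_def)
  show "Z_proc p B \<omega> \<in> cadlag"
    by (rule continuous_on_imp_cadlag[OF _ c]) (simp add: Z_proc_def)
qed

lemma Z_proc_measurable:
  assumes B: "standard_brownian_motion N B" and "t \<in> {0..1}"
  shows "(\<lambda>\<omega>. Z_proc p B \<omega> t) \<in> borel_measurable N"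
proof -
  have "B (t\<^sup>2) \<in> borel_measurable N" using B by (simp add: standard_brownian_motion_def)
  then show ?thesis using assms by (simp add: Z_proc_def)
qed

lemma tendsto_Z_proc_knots:
  assumes B: "standard_brownian_motion N B" and \<omega>: "\<omega> \<in> space N"
    and f: "continuous_map uniform_topology euclideanreal f"
  shows "(\<lambda>k. f (step_path k (\<lambda>i. Z_proc p B \<omega> (real i / real k)))) \<longlonglongrightarrow> (f (Z_proc p B \<omega>) :: real)"
  using f Z_proc_cadlag[OF B \<omega>] unfolding uniform_topology_def
  by (intro unif.continuous_map_dist_null[where f=f] step_path_approx) (auto simp: step_path_cadlag)

lemma borel_measurable_Z_proc_knots:
  assumes B: "standard_brownian_motion N B"
    and f: "continuous_map uniform_topology euclideanreal (f :: _ \<Rightarrow> real)"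
  shows "(\<lambda>\<omega>. f (step_path k (\<lambda>i. Z_proc p B \<omega> (real i / real k)))) \<in> borel_measurable N"
  by (intro borel_measurable_step_path[OF f] Z_proc_measurable[OF B]) (auto simp: divide_le_eq_1)

text \<open>A pointwise limit of functionals of finitely many coordinates, thanks to the continuity
  of the limit paths.\<close>

lemma borel_measurable_Z_proc:
  assumes B: "standard_brownian_motion N B"
    and f: "continuous_map uniform_topology euclideanreal (f :: _ \<Rightarrow> real)"
  shows "(\<lambda>\<omega>. f (Z_proc p B \<omega>)) \<in> borel_measurable N"
  by (rule borel_measurable_LIMSEQ_real[OF tendsto_Z_proc_knots[OF B _ f] borel_measurable_Z_proc_knots[OF B f]])

text \<open>\<open>G\<close> consists of the Brownian increments between the times
  \<open>(l / k)\<^sup>2\<close>, divided by their standard deviations, in the form that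
  \<open>integral_knots_tendsto\<close> asks for.\<close>

lemma integral_Z_proc_knots:
  assumes B: "standard_brownian_motion N B"
    and f: "continuous_map uniform_topology euclideanreal (f :: _ \<Rightarrow> real)" and k: "k \<ge> 1"
    and \<sigma>: "\<sigma>\<^sup>2 = p * (1 - p)"
  obtains G :: "nat \<Rightarrow> 'b \<Rightarrow> real" where
    "prob_space.indep_vars N (\<lambda>_. borel) G {..<k}"
    "\<forall>l<k. distr N borel (G l) = std_normal_distribution"
    "(\<integral>\<omega>. f (step_path k (\<lambda>i. real i / real k *
        (\<Sum>l<i. sqrt (((real (Suc l) / real k)\<^sup>2 / 2 - (real l / real k)\<^sup>2 / 2) * \<sigma>\<^sup>2) * G l \<omega>))) \<partial>N) =
     (\<integral>\<omega>. f (step_path k (\<lambda>i. Z_proc p B \<omega> (real i / real k))) \<partial>(N :: 'b measure))"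
proof -
  interpret N: prob_space N using B by (simp add: standard_brownian_motion_def)
  define \<tau> where "\<tau> l = (real l / real k)\<^sup>2" for l
  have \<tau>: "\<tau> l < \<tau> (Suc l)" for l
    unfolding \<tau>_def using k by (intro power_strict_mono divide_strict_right_mono) auto
  have \<tau>0: "0 \<le> \<tau> l" for l by (simp add: \<tau>_def)
  have Bm: "B (\<tau> l) \<in> borel_measurable N" for l
    using B \<tau>0 by (simp add: standard_brownian_motion_def)
  define G where "G l \<omega> = (B (\<tau> (Suc l)) \<omega> - B (\<tau> l) \<omega>) / sqrt (\<tau> (Suc l) - \<tau> l)" for l \<omega>
  have "N.indep_vars (\<lambda>_. borel) (\<lambda>l \<omega>. B (\<tau> (Suc l)) \<omega> - B (\<tau> l) \<omega>) {..<k}"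
    using B \<tau>0 less_imp_le[OF \<tau>] unfolding standard_brownian_motion_def by blast
  then have 1: "N.indep_vars (\<lambda>_. borel) G {..<k}"
    unfolding G_def by (rule N.indep_vars_compose2) auto
  have 2: "distr N borel (G l) = std_normal_distribution" for l
  proof -
    have "distributed N lborel (\<lambda>\<omega>. B (\<tau> (Suc l)) \<omega> - B (\<tau> l) \<omega>) (normal_density 0 (sqrt (\<tau> (Suc l) - \<tau> l)))"
      using B \<tau>0 \<tau> unfolding standard_brownian_motion_def by blast
    then have "distributed N lborel (G l) std_normal_density"
      using N.normal_standard_normal_convert[of "sqrt (\<tau> (Suc l) - \<tau> l)" "\<lambda>\<omega>. B (\<tau> (Suc l)) \<omega> - B (\<tau> l) \<omega>" 0] \<tau>[of l]
      by (simp add: G_def[abs_def])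
    then show ?thesis
      unfolding distributed_def by (metis distr_cong sets_lborel)
  qed
  \<comment> \<open>The variance of the l-th limiting increment is \<open>q\<^sup>2\<close> times
    the Brownian time step, because \<open>\<sigma>\<^sup>2 / 2 = q\<^sup>2\<close>; this is the
    constant in \<open>Z_proc\<close>.\<close>
  define q where "q = sqrt (p * (1 - p) / 2)"
  have coef: "sqrt (((real (Suc l) / real k)\<^sup>2 / 2 - (real l / real k)\<^sup>2 / 2) * \<sigma>\<^sup>2) * G l \<omega> = q * (B (\<tau> (Suc l)) \<omega> - B (\<tau> l) \<omega>)" for l \<omega>
  proof -
    have "((real (Suc l) / real k)\<^sup>2 / 2 - (real l / real k)\<^sup>2 / 2) * \<sigma>\<^sup>2 = (p * (1 - p) / 2) * (\<tau> (Suc l) - \<tau> l)"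
    proof -
      have "(a / 2 - b / 2) * c = c / 2 * (a - b)" for a b c :: real by (simp add: field_simps)
      then show ?thesis unfolding \<sigma> \<tau>_def .
    qed
    then have sq: "sqrt (((real (Suc l) / real k)\<^sup>2 / 2 - (real l / real k)\<^sup>2 / 2) * \<sigma>\<^sup>2) = q * sqrt (\<tau> (Suc l) - \<tau> l)"
      by (simp only: q_def real_sqrt_mult)
    show ?thesis unfolding sq G_def using \<tau>[of l] by simp
  qed
  have 3: "(\<integral>\<omega>. f (step_path k (\<lambda>i. real i / real k *
        (\<Sum>l<i. sqrt (((real (Suc l) / real k)\<^sup>2 / 2 - (real l / real k)\<^sup>2 / 2) * \<sigma>\<^sup>2) * G l \<omega>))) \<partial>N) =
     (\<integral>\<omega>. f (step_path k (\<lambda>i. Z_proc p B \<omega> (real i / real k))) \<partial>N)"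
  \<comment> \<open>Telescoping leaves \<open>B 0\<close>, which vanishes only almost
    surely.\<close>
  proof (rule integral_cong_AE)
    show "(\<lambda>\<omega>. f (step_path k (\<lambda>i. real i / real k *
        (\<Sum>l<i. sqrt (((real (Suc l) / real k)\<^sup>2 / 2 - (real l / real k)\<^sup>2 / 2) * \<sigma>\<^sup>2) * G l \<omega>)))) \<in> borel_measurable N"
      unfolding coef using Bm by (intro borel_measurable_step_path[OF f]) auto
    show "(\<lambda>\<omega>. f (step_path k (\<lambda>i. Z_proc p B \<omega> (real i / real k)))) \<in> borel_measurable N"
      by (rule borel_measurable_Z_proc_knots[OF B f])
    have "AE \<omega> in N. B 0 \<omega> = 0" using B by (simp add: standard_brownian_motion_def)
    then show "AE \<omega> in N. f (step_path k (\<lambda>i. real i / real k *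
        (\<Sum>l<i. sqrt (((real (Suc l) / real k)\<^sup>2 / 2 - (real l / real k)\<^sup>2 / 2) * \<sigma>\<^sup>2) * G l \<omega>))) =
        f (step_path k (\<lambda>i. Z_proc p B \<omega> (real i / real k)))"
    proof eventually_elim
      case (elim \<omega>)
      have "step_path k (\<lambda>i. real i / real k * (\<Sum>l<i. q * (B (\<tau> (Suc l)) \<omega> - B (\<tau> l) \<omega>))) =
          step_path k (\<lambda>i. Z_proc p B \<omega> (real i / real k))"
      proof (rule step_path_cong)
        fix i assume i: "i \<le> k"
        have "(\<Sum>l<i. q * (B (\<tau> (Suc l)) \<omega> - B (\<tau> l) \<omega>)) = q * (B (\<tau> i) \<omega> - B (\<tau> 0) \<omega>)"
          using sum_lessThan_telescope[of "\<lambda>l. B (\<tau> l) \<omega>" i] by (simp add: sum_distrib_left[symmetric])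
        moreover have "B (\<tau> 0) \<omega> = 0" using elim by (simp add: \<tau>_def)
        moreover have "Z_proc p B \<omega> (real i / real k) = q * (real i / real k) * B (\<tau> i) \<omega>"
          using i by (simp add: Z_proc_def q_def \<tau>_def divide_le_eq_1)
        ultimately show "real i / real k * (\<Sum>l<i. q * (B (\<tau> (Suc l)) \<omega> - B (\<tau> l) \<omega>)) = Z_proc p B \<omega> (real i / real k)"
          by simp
      qed
      then show ?case unfolding coef by simp
    qed
  qed
  show thesis by (rule that[OF 1 _ 3]) (simp add: 2)
qed

text \<open>Four errors of at most r / 4 each: two from the discretisation of the graph path
  (Lipschitz part and bad event), one from the limit on the grid, one from the discretisation of the
  limit process. First \<epsilon> is chosen, then \<open>k\<close>, and only then
  \<open>n \<ge> k\<close>.\<close>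

lemma (in bounded_iid) integral_graph_path_tendsto:
  fixes f :: "(real \<Rightarrow> real) \<Rightarrow> real"
  assumes B: "standard_brownian_motion N B" and \<sigma>: "\<sigma>\<^sup>2 = p * (1 - p)" and L: "0 \<le> L"
    and lip: "\<And>x y. x \<in> cadlag \<Longrightarrow> y \<in> cadlag \<Longrightarrow> \<bar>f x - f y\<bar> \<le> L * uniform_dist x y"
    and C: "\<And>x. x \<in> cadlag \<Longrightarrow> \<bar>f x\<bar> \<le> C"
  shows "(\<lambda>n. \<integral>\<omega>. f (graph_path n \<omega>) \<partial>M) \<longlonglongrightarrow> (\<integral>\<omega>. f (Z_proc p B \<omega>) \<partial>N)"
proof (rule LIMSEQ_I)
  fix r :: real assume r: "r > 0"
  interpret N: prob_space N using B by (simp add: standard_brownian_motion_def)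
  have f: "continuous_map uniform_topology euclideanreal f"
    unfolding uniform_topology_def by (rule unif.lipschitz_continuous_map[OF lip])
  let ?e = "\<lambda>n. \<integral>\<omega>. f (graph_path n \<omega>) \<partial>M"
  let ?d = "\<lambda>k n. \<integral>\<omega>. f (step_path k (\<lambda>i. graph_path n \<omega> (real i / real k))) \<partial>M"
  let ?z = "\<lambda>k. \<integral>\<omega>. f (step_path k (\<lambda>i. Z_proc p B \<omega> (real i / real k))) \<partial>N"
  let ?err = "\<lambda>\<epsilon> k. 2 * C * (2 * (real k + 1) * exp (- (\<epsilon>\<^sup>2 * real k)) + 2 * exp (1 / 8 - \<epsilon> * real k))"
  \<comment> \<open>Makes \<open>L * (4 * \<epsilon>) \<le> r / 4\<close>; the summand 1 covers
    \<open>L = 0\<close>.\<close>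
  define \<epsilon> where "\<epsilon> = r / (16 * (L + 1))"
  have \<epsilon>: "\<epsilon> > 0" using r L by (simp add: \<epsilon>_def)
  have L\<epsilon>: "L * (4 * \<epsilon>) \<le> r / 4"
  proof -
    have "L * (4 * \<epsilon>) \<le> (L + 1) * (4 * \<epsilon>)" using \<epsilon> by (intro mult_right_mono) auto
    also have "\<dots> = r / 4" using L by (simp add: \<epsilon>_def field_simps)
    finally show ?thesis .
  qed
  have "(\<lambda>k. ?err \<epsilon> k) \<longlonglongrightarrow> 0"
  proof -
    have "(\<lambda>k. (real k + 1) * exp (- (a * real k))) \<longlonglongrightarrow> 0" if "a > 0" for a :: real
      using that by real_asymp
    from this[of "\<epsilon>\<^sup>2"] have "(\<lambda>k. (real k + 1) * exp (- (\<epsilon>\<^sup>2 * real k))) \<longlonglongrightarrow> 0" using \<epsilon> by simp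
    moreover have "(\<lambda>k. exp (1 / 8 - \<epsilon> * real k)) \<longlonglongrightarrow> 0"
      using \<epsilon> by real_asymp
    ultimately have "(\<lambda>k. 2 * C * (2 * ((real k + 1) * exp (- (\<epsilon>\<^sup>2 * real k))) + 2 * exp (1 / 8 - \<epsilon> * real k)))
        \<longlonglongrightarrow> 2 * C * (2 * 0 + 2 * 0)"
      by (intro tendsto_intros)
    then show ?thesis by (simp only: mult.assoc mult_zero_right add_0_left)
  qed
  then have 1: "eventually (\<lambda>k. ?err \<epsilon> k < r / 4) sequentially"
    using r by (intro order_tendstoD(2)) auto
  have "?z \<longlonglongrightarrow> (\<integral>\<omega>. f (Z_proc p B \<omega>) \<partial>N)"
  proof (rule integral_dominated_convergence[where w="\<lambda>_. C"])
    show "AE \<omega> in N. (\<lambda>k. f (step_path k (\<lambda>i. Z_proc p B \<omega> (real i / real k)))) \<longlonglongrightarrow> f (Z_proc p B \<omega>)"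
      by (rule AE_I2, rule tendsto_Z_proc_knots[OF B _ f])
  qed (auto intro!: borel_measurable_Z_proc_knots[OF B f] borel_measurable_Z_proc[OF B f] C step_path_cadlag)
  then have 2: "eventually (\<lambda>k. dist (?z k) (\<integral>\<omega>. f (Z_proc p B \<omega>) \<partial>N) < r / 4) sequentially"
    using r by (intro tendstoD) auto
  have "eventually (\<lambda>k. ?err \<epsilon> k < r / 4 \<and> dist (?z k) (\<integral>\<omega>. f (Z_proc p B \<omega>) \<partial>N) < r / 4 \<and> 1 \<le> k) sequentially"
    by (intro eventually_conj 1 2 eventually_ge_at_top)
  then obtain k where k: "?err \<epsilon> k < r / 4" "dist (?z k) (\<integral>\<omega>. f (Z_proc p B \<omega>) \<partial>N) < r / 4" "1 \<le> k"
    unfolding eventually_sequentially by blast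
  obtain G where G: "N.indep_vars (\<lambda>_. borel) G {..<k}"
    "\<forall>l<k. distr N borel (G l) = std_normal_distribution"
    "(\<integral>\<omega>. f (step_path k (\<lambda>i. real i / real k *
        (\<Sum>l<i. sqrt (((real (Suc l) / real k)\<^sup>2 / 2 - (real l / real k)\<^sup>2 / 2) * \<sigma>\<^sup>2) * G l \<omega>))) \<partial>N) = ?z k"
    by (rule integral_Z_proc_knots[OF B f k(3) \<sigma>]) (rule that)
  have "?d k \<longlonglongrightarrow> ?z k"
    using integral_knots_tendsto[OF N.prob_space_axioms G(1) G(2)[rule_format] f C k(3)] unfolding G(3) .
  then have "eventually (\<lambda>n. dist (?d k n) (?z k) < r / 4) sequentially"
    using r by (intro tendstoD) auto
  then have "eventually (\<lambda>n. norm (?e n - (\<integral>\<omega>. f (Z_proc p B \<omega>) \<partial>N)) < r) sequentially"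
    using eventually_ge_at_top[of k]
  proof eventually_elim
    case (elim n)
    have "\<bar>?e n - ?d k n\<bar> \<le> L * (4 * \<epsilon>) + ?err \<epsilon> k"
      by (rule integral_knots_approx[OF k(3) elim(2) \<epsilon> L lip C])
    then show ?case using elim(1) k(1,2) L\<epsilon> unfolding dist_real_def real_norm_def by linarith
  qed
  then show "\<exists>n0. \<forall>n\<ge>n0. norm (?e n - (\<integral>\<omega>. f (Z_proc p B \<omega>) \<partial>N)) < r"
    by (simp add: eventually_sequentially)
qed

section \<open>From the random graph to an i.i.d. sequence\<close>


definition edges :: "nat \<Rightarrow> (nat \<times> nat) set" where
  "edges m = {(i, j). 1 \<le> i \<and> i < j \<and> j \<le> m}"

definition edge_index :: "nat \<times> nat \<Rightarrow> nat" where
  "edge_index = (\<lambda>(i, j). ((j - 1) choose 2) + (i - 1))"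

lemma finite_edges [simp]: "finite (edges m)"
  by (rule finite_subset[of _ "{..m} \<times> {..m}"]) (auto simp: edges_def)

lemma edges_mono: "m \<le> n \<Longrightarrow> edges m \<subseteq> edges n"
  by (auto simp: edges_def)

text \<open>Vertex \<open>Suc m\<close> contributes \<open>m\<close> edges whose indices continue
  exactly where those of \<open>edges m\<close> stop. One enumeration therefore works for all
  \<open>m\<close> at once, and sums over \<open>edges m\<close> become partial sums of a single
  sequence.\<close>

lemma bij_betw_edge_index: "bij_betw edge_index (edges m) {..<m choose 2}"
proof (induction m)
  case 0
  have "edges 0 = {}" by (auto simp: edges_def)
  then show ?case by (simp add: bij_betw_def choose_two)
next
  case (Suc m)
  have 1: "edges (Suc m) = edges m \<union> (\<lambda>i. (i, Suc m)) ` {1..m}"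
    by (auto simp: edges_def le_Suc_eq)
  have c: "Suc m choose 2 = (m choose 2) + m"
    by (simp add: numeral_2_eq_2)
  have 2: "{..<Suc m choose 2} = {..<m choose 2} \<union> {m choose 2..<(m choose 2) + m}"
    unfolding c by auto
  have "bij_betw edge_index ((\<lambda>i. (i, Suc m)) ` {1..m}) {m choose 2..<(m choose 2) + m}"
    unfolding bij_betw_def
  proof
    show "inj_on edge_index ((\<lambda>i. (i, Suc m)) ` {1..m})"
      by (auto simp: inj_on_def edge_index_def)
    have "(\<lambda>i. (m choose 2) + (i - 1)) ` {1..m} = {m choose 2..<(m choose 2) + m}"
    proof (intro equalityI subsetI)
      fix x assume "x \<in> {m choose 2..<(m choose 2) + m}"
      then show "x \<in> (\<lambda>i. (m choose 2) + (i - 1)) ` {1..m}"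
        by (intro image_eqI[of _ _ "x - (m choose 2) + 1"]) auto
    qed auto
    then show "edge_index ` (\<lambda>i. (i, Suc m)) ` {1..m} = {m choose 2..<(m choose 2) + m}"
      by (simp add: image_image edge_index_def)
  qed
  then show ?case
    unfolding 1 2 by (intro bij_betw_combine Suc) auto
qed

definition bernoulli_sequence :: "real \<Rightarrow> (nat \<Rightarrow> bool) measure" where
  "bernoulli_sequence p = PiM UNIV (\<lambda>_. measure_pmf (bernoulli_pmf p))"

lemma prob_space_bernoulli_sequence: "prob_space (bernoulli_sequence p)"
  unfolding bernoulli_sequence_def by (intro prob_space_PiM measure_pmf.prob_space_axioms)

text \<open>An arbitrary injection covers both the sequence itself and its reading through
  \<open>edge_index\<close>.\<close>

lemma indep_vars_bernoulli_sequence: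
  assumes "inj_on h K"
  shows "prob_space.indep_vars (bernoulli_sequence p) (\<lambda>_. count_space UNIV) (\<lambda>e \<omega>. \<omega> (h e)) K"
proof -
  interpret P: prob_space "bernoulli_sequence p" by (rule prob_space_bernoulli_sequence)
  have ind: "P.indep_vars (\<lambda>_. measure_pmf (bernoulli_pmf p)) (\<lambda>i \<omega>. \<omega> i) UNIV"
    unfolding bernoulli_sequence_def
    by (rule indep_vars_PiM_components) (rule measure_pmf.prob_space_axioms)
  have "P.indep_vars (\<lambda>e. PiM {h e} (\<lambda>_. measure_pmf (bernoulli_pmf p))) (\<lambda>e \<omega>. restrict (\<lambda>i. \<omega> i) {h e}) K"
    by (intro P.indep_vars_restrict[OF ind]) (use assms in \<open>auto simp: disjoint_family_on_def inj_on_def\<close>)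
  then have "P.indep_vars (\<lambda>_. count_space UNIV) (\<lambda>e \<omega>. restrict (\<lambda>i. \<omega> i) {h e} (h e)) K"
    by (rule P.indep_vars_compose2[where Y="\<lambda>e u. u (h e)"])
      (auto intro!: measurable_compose[OF measurable_component_singleton])
  then show ?thesis by simp
qed

lemma distr_bernoulli_sequence:
  "distr (bernoulli_sequence p) (count_space UNIV) (\<lambda>\<omega>. \<omega> i) = measure_pmf (bernoulli_pmf p)"
proof -
  have "distr (bernoulli_sequence p) (count_space UNIV) (\<lambda>\<omega>. \<omega> i) =
      distr (bernoulli_sequence p) (measure_pmf (bernoulli_pmf p)) (\<lambda>\<omega>. \<omega> i)"
    by (rule distr_cong) auto
  also have "\<dots> = measure_pmf (bernoulli_pmf p)"
    unfolding bernoulli_sequence_def by (intro distr_PiM_component measure_pmf.prob_space_axioms) auto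
  finally show ?thesis .
qed

lemma bounded_iid_bernoulli_sequence:
  assumes p: "0 < p" "p < 1"
  shows "bounded_iid (bernoulli_sequence p) (\<lambda>i \<omega>. of_bool (\<omega> i) - p)
    (distr (measure_pmf (bernoulli_pmf p)) borel (\<lambda>b. of_bool b - p)) (- p) (sqrt (p * (1 - p)))"
proof -
  interpret P: prob_space "bernoulli_sequence p" by (rule prob_space_bernoulli_sequence)
  have [measurable]: "(\<lambda>\<omega>. \<omega> i) \<in> measurable (bernoulli_sequence p) (count_space UNIV)" for i
    using indep_vars_bernoulli_sequence[of id UNIV p] unfolding P.indep_vars_def by auto
  have int: "P.expectation (\<lambda>\<omega>. g (\<omega> i)) = p * g True + (1 - p) * g False" for g :: "bool \<Rightarrow> real" and i
  proof -
    have "P.expectation (\<lambda>\<omega>. g (\<omega> i)) = integral\<^sup>L (distr (bernoulli_sequence p) (count_space UNIV) (\<lambda>\<omega>. \<omega> i)) g"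
      by (rule integral_distr[symmetric]) auto
    also have "\<dots> = p * g True + (1 - p) * g False"
      unfolding distr_bernoulli_sequence using p by simp
    finally show ?thesis .
  qed
  show ?thesis
  proof
    show "P.indep_vars (\<lambda>_. borel) (\<lambda>i \<omega>. of_bool (\<omega> i) - p) UNIV"
      by (rule P.indep_vars_compose2[OF indep_vars_bernoulli_sequence[of "\<lambda>i. i", OF inj_on_id2]]) auto
    show "distr (bernoulli_sequence p) borel (\<lambda>\<omega>. of_bool (\<omega> i) - p) =
        distr (measure_pmf (bernoulli_pmf p)) borel (\<lambda>b. of_bool b - p)" for i
      unfolding distr_bernoulli_sequence[of p i, symmetric] by (subst distr_distr) (auto simp: o_def)
    show "P.expectation (\<lambda>\<omega>. of_bool (\<omega> i) - p) = 0" for i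
      using int[of "\<lambda>b. of_bool b - p" i] by (simp add: algebra_simps)
    have "p * (1 - p)\<^sup>2 + (1 - p) * p\<^sup>2 = p * (1 - p)" by (simp add: power2_eq_square algebra_simps)
    then show "P.expectation (\<lambda>\<omega>. (of_bool (\<omega> i) - p)\<^sup>2) = (sqrt (p * (1 - p)))\<^sup>2" for i
      using int[of "\<lambda>b. (of_bool b - p)\<^sup>2" i] p by simp
    show "0 < sqrt (p * (1 - p))" using p by simp
  qed (auto simp: of_bool_def)
qed

text \<open>At a fixed time the expectation is the prefactor times p for every edge, so the centring
  can be moved into the sum, edge by edge.\<close>

lemma Y_proc_eq_step_path:
  assumes I: "bernoulli_edges M p n I" and p: "0 < p" "p < 1"
  shows "Y_proc M n I \<omega> =
    step_path n (\<lambda>m. (real m - 2) / (real n)\<^sup>2 * (\<Sum>e\<in>edges m. of_bool (case e of (i, j) \<Rightarrow> I i j \<omega>) - p))"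
    (is "_ = step_path n ?w")
proof (rule ext)
  fix t
  interpret prob_space M using I by (simp add: bernoulli_edges_def)
  show "Y_proc M n I \<omega> t = step_path n ?w t"
  proof (cases "t \<in> {0..1}")
    case True
    define m where "m = nat \<lfloor>real n * t\<rfloor>"
    have m: "\<lfloor>real n * t\<rfloor> = int m" "m \<le> n" using True step_path_index[OF True, of n] by (auto simp: m_def)
    have T: "T_proc n I t \<omega>' = (real m - 2) / (real n)\<^sup>2 * (\<Sum>e\<in>edges m. of_bool (case e of (i, j) \<Rightarrow> I i j \<omega>'))" for \<omega>'
      unfolding T_proc_def m edges_def by (auto simp: case_prod_beta intro!: sum.cong)
    have E: "has_bochner_integral M (\<lambda>\<omega>'. of_bool (case e of (i, j) \<Rightarrow> I i j \<omega>') :: real) p" if em: "e \<in> edges m" for e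
    proof -
      obtain i j where e: "e = (i, j)" "1 \<le> i" "i < j" "j \<le> n" using em m(2) by (auto simp: edges_def)
      then have rv: "I i j \<in> measurable M (count_space UNIV)"
        using I unfolding bernoulli_edges_def indep_vars_def by auto
      have "integrable M (\<lambda>\<omega>'. of_bool (I i j \<omega>') :: real)"
        by (rule integrable_const_bound[of _ 1]) (use rv in auto)
      moreover have "(\<integral>\<omega>'. of_bool (I i j \<omega>') \<partial>M) = integral\<^sup>L (distr M (count_space UNIV) (I i j)) (of_bool :: bool \<Rightarrow> real)"
        by (rule integral_distr[symmetric]) (use rv in auto)
      moreover have "distr M (count_space UNIV) (I i j) = measure_pmf (bernoulli_pmf p)"
        using I e by (simp add: bernoulli_edges_def)
      ultimately show ?thesis using p e by (simp add: has_bochner_integral_iff)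
    qed
    have "has_bochner_integral M (T_proc n I t) ((real m - 2) / (real n)\<^sup>2 * (\<Sum>e\<in>edges m. p))"
      unfolding T[abs_def] by (intro has_bochner_integral_mult_right has_bochner_integral_sum E)
    then have "(\<integral>\<omega>'. T_proc n I t \<omega>' \<partial>M) = (real m - 2) / (real n)\<^sup>2 * (\<Sum>e\<in>edges m. p)"
      by (rule has_bochner_integral_integral_eq)
    then have "Y_proc M n I \<omega> t = T_proc n I t \<omega> - (real m - 2) / (real n)\<^sup>2 * (\<Sum>e\<in>edges m. p)"
      using True by (simp add: Y_proc_def)
    also have "\<dots> = ?w m" unfolding T sum_subtractf right_diff_distrib ..
    finally show ?thesis using True by (simp add: step_path_def m_def)
  qed (auto simp: Y_proc_def step_path_def)
qed

lemma borel_measurable_Y_proc: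
  assumes I: "bernoulli_edges M p n I" and p: "0 < p" "p < 1"
    and f: "continuous_map uniform_topology euclideanreal (f :: _ \<Rightarrow> real)"
  shows "(\<lambda>\<omega>. f (Y_proc M n I \<omega>)) \<in> borel_measurable M"
  unfolding Y_proc_eq_step_path[OF I p]
proof (intro borel_measurable_step_path[OF f] borel_measurable_times borel_measurable_const borel_measurable_sum borel_measurable_diff)
  interpret prob_space M using I by (simp add: bernoulli_edges_def)
  fix m e assume "m \<le> n" "e \<in> edges m"
  then obtain i j where e: "e = (i, j)" "1 \<le> i" "i < j" "j \<le> n" by (auto simp: edges_def)
  then have "I i j \<in> measurable M (count_space UNIV)"
    using I unfolding bernoulli_edges_def indep_vars_def by auto
  then show "(\<lambda>\<omega>. of_bool (case e of (i, j) \<Rightarrow> I i j \<omega>) :: real) \<in> borel_measurable M"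
    by (simp add: e)
qed

text \<open>Both integrands are the same function \<open>g\<close> of the finite family of edge
  indicators, and the two families have the same joint law.\<close>

lemma integral_Y_proc:
  assumes I: "bernoulli_edges M p n I" and p: "0 < p" "p < 1"
  shows "(\<integral>\<omega>. f (Y_proc M n I \<omega>) \<partial>M) =
    (\<integral>\<omega>. f (bounded_iid.graph_path (\<lambda>i \<omega>. of_bool (\<omega> i) - p) n \<omega>) \<partial>bernoulli_sequence p :: real)"
proof -
  interpret M: prob_space M using I by (simp add: bernoulli_edges_def)
  interpret P: bounded_iid "bernoulli_sequence p" "\<lambda>i \<omega>. of_bool (\<omega> i) - p"
    "distr (measure_pmf (bernoulli_pmf p)) borel (\<lambda>b. of_bool b - p)" "- p" "sqrt (p * (1 - p))"
    by (rule bounded_iid_bernoulli_sequence[OF p])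
  define g where "g u = f (step_path n (\<lambda>m. (real m - 2) / (real n)\<^sup>2 * (\<Sum>e\<in>edges m. of_bool (u e) - p)))"
    for u :: "nat \<times> nat \<Rightarrow> bool"
  have restr: "g (\<lambda>e\<in>edges n. v e) = g v" for v
    unfolding g_def using edges_mono
    by (intro arg_cong[where f=f] step_path_cong arg_cong2[where f="(*)"] refl sum.cong) (auto simp: subset_eq)
  have 1: "f (Y_proc M n I \<omega>) = g (\<lambda>e\<in>edges n. case e of (i, j) \<Rightarrow> I i j \<omega>)" for \<omega>
    unfolding restr by (simp add: g_def Y_proc_eq_step_path[OF I p])
  have 2: "f (P.graph_path n \<omega>) = g (\<lambda>e\<in>edges n. \<omega> (edge_index e))" for \<omega>
  proof -
    have "P.S (m choose 2) \<omega> = (\<Sum>e\<in>edges m. of_bool (\<omega> (edge_index e)) - p)" for m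
      unfolding P.S_def by (rule sum.reindex_bij_betw[OF bij_betw_edge_index, symmetric])
    then show ?thesis unfolding restr by (simp add: g_def P.graph_path_def)
  qed
  \<comment> \<open>A finite product of discrete two-point spaces is discrete, so \<open>g\<close>
    is measurable whatever \<open>f\<close> is.\<close>
  have "PiM (edges n) (\<lambda>_. count_space (UNIV :: bool set)) = count_space (PiE (edges n) (\<lambda>_. UNIV))"
    by (rule count_space_PiM_finite) auto
  then have gm: "g \<in> borel_measurable (PiM (edges n) (\<lambda>_. count_space UNIV))" by simp
  show ?thesis unfolding 1 2
  proof (rule integral_indep_vars_eq[OF M.prob_space_axioms P.prob_space_axioms _ _ _ gm])
    have "edges n = {(i, j). 1 \<le> i \<and> i < j \<and> j \<le> n}" by (simp add: edges_def)
    then show "M.indep_vars (\<lambda>_. count_space UNIV) (\<lambda>e \<omega>. case e of (i, j) \<Rightarrow> I i j \<omega>) (edges n)"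
      using I unfolding bernoulli_edges_def by (simp add: case_prod_beta')
    show "P.indep_vars (\<lambda>_. count_space UNIV) (\<lambda>e \<omega>. \<omega> (edge_index e)) (edges n)"
      by (rule indep_vars_bernoulli_sequence) (rule bij_betw_imp_inj_on[OF bij_betw_edge_index])
    show "distr M (count_space UNIV) (\<lambda>\<omega>. case e of (i, j) \<Rightarrow> I i j \<omega>) =
        distr (bernoulli_sequence p) (count_space UNIV) (\<lambda>\<omega>. \<omega> (edge_index e))" if "e \<in> edges n" for e
      using that I unfolding distr_bernoulli_sequence by (auto simp: bernoulli_edges_def edges_def)
  qed
qed

section \<open>From the uniform to the Skorokhod topology, and the conclusion\<close>

lemma openin_skorokhod_imp_uniform:
  assumes "openin skorokhod_topology U"
  shows "openin uniform_topology U"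
proof -
  interpret sk: Metric_space cadlag skorokhod_dist by (rule Metric_space_skorokhod)
  have "unif.mball x r \<subseteq> sk.mball x r" for x r
    using skorokhod_dist_le_uniform_dist le_less_trans by (fastforce simp: unif.in_mball sk.in_mball)
  then show ?thesis
    using assms unfolding uniform_topology_def skorokhod_topology_def unif.openin_mtopology sk.openin_mtopology
    by (meson order_trans)
qed

lemma topspace_path_topologies [simp]:
  "topspace uniform_topology = cadlag" "topspace skorokhod_topology = cadlag"
  by (simp_all add: uniform_topology_def skorokhod_topology_def Metric_space.topspace_mtopology[OF Metric_space_skorokhod])

lemma measurable_borel_of_skorokhod:
  assumes W: "W \<in> measurable A (borel_of uniform_topology)"
  shows "W \<in> measurable A (borel_of skorokhod_topology)"
  unfolding borel_of_def
proof (rule measurable_measure_of)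
  have sub: "{U. openin uniform_topology U} \<subseteq> Pow (topspace uniform_topology)"
    using openin_subset by blast
  show "W \<in> space A \<rightarrow> topspace skorokhod_topology"
    using measurable_space[OF W] sub by (auto simp: borel_of_def space_measure_of)
  fix U assume "U \<in> {U. openin skorokhod_topology U}"
  then have "U \<in> sets (borel_of uniform_topology)"
    using openin_skorokhod_imp_uniform sub unfolding borel_of_def by (auto simp: sets_measure_of)
  then show "W -` U \<inter> space A \<in> sets A" by (rule measurable_sets[OF W])
qed (use openin_subset in blast)

text \<open>A coarser topology has fewer continuous functionals and fewer Borel sets.\<close>

lemma converges_in_distribution_uniform_imp_skorokhod:
  assumes "converges_in_distribution uniform_topology M X N Z"
  shows "converges_in_distribution skorokhod_topology M X N Z"
proof -
  have "continuous_map uniform_topology euclideanreal f" if "continuous_map skorokhod_topology euclideanreal f" for f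
    using that openin_skorokhod_imp_uniform by (auto simp: continuous_map_def)
  then show ?thesis
    using assms unfolding converges_in_distribution_def by (auto intro: measurable_borel_of_skorokhod)
qed

theorem mainTheorem6:
  fixes p :: real
    and M :: "nat \<Rightarrow> 'a measure" and I :: "nat \<Rightarrow> nat \<Rightarrow> nat \<Rightarrow> 'a \<Rightarrow> bool"
    and N :: "'b measure" and B :: "real \<Rightarrow> 'b \<Rightarrow> real"
  assumes "0 < p" and "p < 1"
    and "\<And>n. n \<ge> 1 \<Longrightarrow> bernoulli_edges (M n) p n (I n)"
    and "standard_brownian_motion N B"
  shows "converges_in_distribution skorokhod_topology M (\<lambda>n. Y_proc (M n) n (I n)) N (Z_proc p B) \<and>
         converges_in_distribution uniform_topology M (\<lambda>n. Y_proc (M n) n (I n)) N (Z_proc p B)"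
proof -
  note p = assms(1,2) and I = assms(3) and B = assms(4)
  interpret N: prob_space N using B by (simp add: standard_brownian_motion_def)
  interpret P: bounded_iid "bernoulli_sequence p" "\<lambda>i \<omega>. of_bool (\<omega> i) - p"
    "distr (measure_pmf (bernoulli_pmf p)) borel (\<lambda>b. of_bool b - p)" "- p" "sqrt (p * (1 - p))"
    by (rule bounded_iid_bernoulli_sequence[OF p])
  have Ycad: "Y_proc (M n) n (I n) \<omega> \<in> cadlag" if "n \<ge> 1" for n \<omega>
    unfolding Y_proc_eq_step_path[OF I[OF that] p] by (rule step_path_cadlag)
  \<comment> \<open>The edge hypothesis starts at \<open>n = 1\<close>, but measurability is
    demanded for every \<open>n\<close>. At \<open>n = 0\<close> division by 0 makes the path vanish
    on the unit interval.\<close>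
  have Y0: "Y_proc (M 0) 0 (I 0) = (\<lambda>_. step_path 0 (\<lambda>_. 0))"
    by (auto simp: Y_proc_def T_proc_def step_path_def fun_eq_iff)
  have "Y_proc (M n) n (I n) \<in> measurable (M n) (borel_of uniform_topology)" for n
  proof (cases "n = 0")
    case True
    then show ?thesis
      unfolding uniform_topology_def by (intro unif.measurable_borel_ofI) (auto simp: Y0 step_path_cadlag)
  next
    case False
    then show ?thesis
      unfolding uniform_topology_def
      by (intro unif.measurable_borel_ofI Ycad borel_measurable_Y_proc[OF I p]) (auto simp: uniform_topology_def)
  qed
  moreover have "Z_proc p B \<in> measurable N (borel_of uniform_topology)"
    unfolding uniform_topology_def
    by (intro unif.measurable_borel_ofI Z_proc_cadlag(1)[OF B] borel_measurable_Z_proc[OF B]) (auto simp: uniform_topology_def)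
  moreover have "(\<lambda>n. \<integral>\<omega>. f (Y_proc (M n) n (I n) \<omega>) \<partial>M n) \<longlonglongrightarrow> (\<integral>\<omega>. f (Z_proc p B \<omega>) \<partial>N)"
    if f: "continuous_map uniform_topology euclideanreal f" "bounded (f ` topspace uniform_topology)" for f
  proof -
    obtain C where C: "\<And>x. x \<in> cadlag \<Longrightarrow> \<bar>f x\<bar> \<le> C" using f(2) by (auto simp: bounded_iff)
    \<comment> \<open>The index is shifted because nothing makes \<open>M 0\<close> a probability
      space.\<close>
    have "(\<lambda>n. \<integral>\<omega>. f (Y_proc (M (Suc n)) (Suc n) (I (Suc n)) \<omega>) \<partial>M (Suc n)) \<longlonglongrightarrow> (\<integral>\<omega>. f (Z_proc p B \<omega>) \<partial>N)"
    proof (rule unif.weak_convergence_lipschitzI[where f=f and C=C])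
      show "prob_space (M (Suc n))" for n using I[of "Suc n"] by (simp add: bernoulli_edges_def)
      fix f :: "(real \<Rightarrow> real) \<Rightarrow> real" and L C
      assume f: "0 \<le> L" "\<And>x y. x \<in> cadlag \<Longrightarrow> y \<in> cadlag \<Longrightarrow> \<bar>f x - f y\<bar> \<le> L * uniform_dist x y"
        "\<And>x. x \<in> cadlag \<Longrightarrow> \<bar>f x\<bar> \<le> C"
      have "(\<lambda>n. \<integral>\<omega>. f (P.graph_path n \<omega>) \<partial>bernoulli_sequence p) \<longlonglongrightarrow> (\<integral>\<omega>. f (Z_proc p B \<omega>) \<partial>N)"
        by (rule P.integral_graph_path_tendsto[OF B _ f]) (use p in simp)
      then have "(\<lambda>n. \<integral>\<omega>. f (P.graph_path (Suc n) \<omega>) \<partial>bernoulli_sequence p) \<longlonglongrightarrow> (\<integral>\<omega>. f (Z_proc p B \<omega>) \<partial>N)"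
        by (rule LIMSEQ_Suc)
      then show "(\<lambda>n. \<integral>\<omega>. f (Y_proc (M (Suc n)) (Suc n) (I (Suc n)) \<omega>) \<partial>M (Suc n)) \<longlonglongrightarrow> (\<integral>\<omega>. f (Z_proc p B \<omega>) \<partial>N)"
        by (simp add: integral_Y_proc[OF I p])
    qed (use f C in \<open>auto simp: uniform_topology_def N.prob_space_axioms
      intro!: Ycad Z_proc_cadlag(1)[OF B] borel_measurable_Y_proc[OF I p] borel_measurable_Z_proc[OF B]\<close>)
    then show ?thesis by (rule LIMSEQ_imp_Suc)
  qed
  ultimately have "converges_in_distribution uniform_topology M (\<lambda>n. Y_proc (M n) n (I n)) N (Z_proc p B)"
    unfolding converges_in_distribution_def by blast
  then show ?thesis using converges_in_distribution_uniform_imp_skorokhod by blast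
qed

end
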